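(* Let $(X,\Sigma,\mu)$ be a complete, $\sigma$-finite measure space and $\ell$ a von Neumann lifting of $\mu$. Let $\mathbb B$ be a Banach space and $\mathbf E$ a Banach $\mathbb B$-bundle over $(X,\Sigma)$. Then there exists a map $\ell\colon\Gamma_\infty(\mu;\mathbf E)\to\mathcal L^\infty(\mu;\mathbb B'')$ such that: (a) $\ell(v)(x)=J_{\mathbb B}(\hat v(x))$ for every $v\in\Gamma_\infty(\mu;\mathbf E)$ and $\mu$-a.e. $x\in X$; (b) $\ell(v+w)(x)=\ell(v)(x)+\ell(w)(x)$ for every $v,w\in\Gamma_\infty(\mu;\mathbf E)$ and every $x\in X$; (c) $\ell(f\cdot v)(x)=\ell(f)(x)\,\ell(v)(x)$ for every $v\in\Gamma_\infty(\mu;\mathbf E)$, $f\in L^\infty(\mu)$ and every $x\in X$; (d) $\|\ell(v)(x)\|_{\mathbb B''}\leq\ell\big(\|v(\cdot)\|_{\mathbb B}\big)(x)$ for every $v\in\Gamma_\infty(\mu;\mathbf E)$ and every $x\in X$. In particular, $\ell\colon\Gamma_\infty(\mu;\mathbf E)\to\mathcal L^\infty(\mu;\mathbb B'')$ is linear and continuous. Moreover, in the case where $\mathbf E$ is the constant bundle $\mathbb B$ (i.e. $\mathbf E(x)=\mathbb B$ for every $x\in X$), one can additionally require that (e) $\ell(\mathbf 1_X^\mu\,\bar v)(x)=J_{\mathbb B}(\bar v)$ for every $\bar v\in\mathbb B$ and every $x\in X$.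
   Context: Von Neumann lifting: for a measure space $(X,\Sigma,\mu)$ with $\mu\neq 0$, a map $\ell\colon\Sigma\to\Sigma$ is a von Neumann lifting of $\mu$ if (i) $\ell(\varnothing)=\varnothing$, $\ell(X)=X$, $\ell(E\cap F)=\ell(E)\cap\ell(F)$ and $\ell(E\cup F)=\ell(E)\cup\ell(F)$ for all $E,F\in\Sigma$; (ii) $\ell(E)=\ell(F)$ whenever $\mu(E\Delta F)=0$; (iii) $\mu(E\Delta\ell(E))=0$ for every $E\in\Sigma$. $\mathcal L^\infty(\Sigma)$ is the Banach space of bounded measurable functions $X\to\mathbb R$ with the supremum norm; $L^\infty(\mu)$ is its quotient up to $\mu$-a.e. equality with the quotient norm; $\mathbf 1_E^\mu\in L^\infty(\mu)$ is the class of the characteristic function $\mathbf 1_E$. Every von Neumann lifting $\ell$ induces a unique linear continuous map $\ell\colon L^\infty(\mu)\to\mathcal L^\infty(\Sigma)$ with $\ell(\mathbf 1_E^\mu)=\mathbf 1_{\ell(E)}$ for all $E\in\Sigma$; it is multiplicative, norm-preserving, and $\ell(f)$ is a representative of $f$. This is the map $\ell$ applied to functions in (c) and (d); the same symbol is used for the maps on sets, functions and sections. $\mathbb B'$, $\mathbb B''$ are the dual and bidual of $\mathbb B$, and $J_{\mathbb B}\colon\mathbb B\to\mathbb B''$ is the canonical embedding. A map $v\colon X\to\mathbb B$ is strongly measurable if it is $\mu$-measurable and it is the $\mu$-a.e. norm limit of a sequence of $\mathbb B$-simple maps $\sum_{i=1}^n\mathbf 1_{E_i}v_i$ ($E_i\in\Sigma$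 pairwise disjoint, $\mu(E_i)<\infty$, $v_i\in\mathbb B$). $\mathcal L^\infty(\mu;\mathbb B)$ is the space of strongly measurable $v\colon X\to\mathbb B$ with $\|v(\cdot)\|_{\mathbb B}\in\mathcal L^\infty(\Sigma)$, with norm $\sup_{x}\|v(x)\|_{\mathbb B}$; $L^\infty(\mu;\mathbb B)$ is its quotient up to $\mu$-a.e. equality, with norm $\big\|\|v(\cdot)\|_{\mathbb B}\big\|_{L^\infty(\mu)}$; $\pi_\mu$ is the quotient map. ($\mathcal L^\infty(\mu;\mathbb B'')$ is defined in the same way.) A Banach $\mathbb B$-bundle over $(X,\Sigma)$ is a multivalued map $\mathbf E$ assigning to every $x\in X$ a closed linear subspace $\mathbf E(x)$ of $\mathbb B$, such that $\{x\in X:\mathbf E(x)\cap U\neq\varnothing\}\in\Sigma$ for every open $U\subset\mathbb B$. $\bar\Gamma_\infty(\mu;\mathbf E)$ is the set of $v\in\mathcal L^\infty(\mu;\mathbb B)$ with $v(x)\in\mathbf E(x)$ for every $x\in X$, and $\Gamma_\infty(\mu;\mathbf E):=\pi_\mu(\bar\Gamma_\infty(\mu;\mathbf E))\subset L^\infty(\mu;\mathbb B)$, with the norm of $L^\infty(\mu;\mathbb B)$. Precise representative $\hat v\in\bar\Gamma_\infty(\mu;\mathbf E)$ of $v\in\Gamma_\infty(\mu;\mathbf E)$: put $\mathcal I^\ell:=\{\ell(E):E\in\Sigma,\ 0<\mu(E)<\infty\}$ and $\mathcal I^\ell_x:=\{I\in\mathcal I^\ell:x\in I\}$. For a map $\Phi$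 on $\mathcal I^\ell$ and $x$ with $\mathcal I^\ell_x\ne\varnothing$, $\lim_{I\Rightarrow x}\Phi(I)=z$ means that for every open neighbourhood $U$ of $z$ there is $I\in\mathcal I^\ell_x$ with $\Phi(J)\in U$ for every $J\in\mathcal I^\ell_x$, $J\subset I$. Then $\hat v(x):=\lim_{I\Rightarrow x}\frac1{\mu(I)}\int_I v\,d\mu$ (Bochner integral, norm limit) whenever this limit exists and belongs to $\mathbf E(x)$ (which is the case for $\mu$-a.e. $x$), and $\hat v(x):=0$ otherwise; $\hat v$ is a representative of $v$. *)

theory Defs
  imports "HOL-Analysis.Analysis"
begin

definition von_neumann_lifting :: "'x measure \<Rightarrow> ('x set \<Rightarrow> 'x set) \<Rightarrow> bool" where
  "von_neumann_lifting M l \<longleftrightarrow>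
     emeasure M (space M) \<noteq> 0 \<and>
     l \<in> sets M \<rightarrow> sets M \<and>
     l {} = {} \<and> l (space M) = space M \<and>
     (\<forall>E\<in>sets M. \<forall>F\<in>sets M. l (E \<inter> F) = l E \<inter> l F \<and> l (E \<union> F) = l E \<union> l F) \<and>
     (\<forall>E\<in>sets M. \<forall>F\<in>sets M. emeasure M (sym_diff E F) = 0 \<longrightarrow> l E = l F) \<and>
     (\<forall>E\<in>sets M. emeasure M (sym_diff E (l E)) = 0)"

text \<open>
  A function on the set \<open>X = space M\<close> is encoded as a total function that vanishes outside
  \<open>space M\<close>; in this way the function spaces below are genuine vector spaces of functions on
  \<open>space M\<close>.
\<close>

definition Linf :: "'x measure \<Rightarrow> ('x \<Rightarrow> real) set" where
  "Linf M = {f. f \<in> borel_measurable M \<and> bounded (f ` space M) \<and> (\<forall>x. x \<notin> space M \<longrightarrow> f x = 0)}"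

text \<open>
  The simple maps are the library's \<open>simple_bochner_integrable\<close> ones: measurable, with finitely many
  values, and vanishing outside a set of finite measure.
  The target space is not assumed to be separable; this is why the a.e. approximation by
  simple maps has to be required in addition to measurability.
\<close>

definition strongly_measurable :: "'x measure \<Rightarrow> ('x \<Rightarrow> 'b::real_normed_vector) \<Rightarrow> bool" where
  "strongly_measurable M v \<longleftrightarrow>
     v \<in> borel_measurable M \<and>
     (\<exists>s. (\<forall>n. Bochner_Integration.simple_bochner_integrable M (s n)) \<and>
          (AE x in M. (\<lambda>n. s n x) \<longlonglongrightarrow> v x))"

definition LinfB :: "'x measure \<Rightarrow> ('x \<Rightarrow> 'b::real_normed_vector) set" where
  "LinfB M = {v. strongly_measurable M v \<and> (\<lambda>x. norm (v x)) \<in> Linf M}"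

definition sup_norm :: "'x measure \<Rightarrow> ('x \<Rightarrow> 'b::real_normed_vector) \<Rightarrow> real" where
  "sup_norm M v = (SUP x\<in>space M. norm (v x))"

text \<open>
  Quotients up to a.e. equality: \<open>ae_class M S v\<close> is the class of \<open>v\<close> in the function space
  \<open>S\<close>, and \<open>lift1\<close>, \<open>lift2\<close> are the operations on classes, with values in the
  quotient of \<open>S\<close>, that are induced by pointwise operations on representatives.
\<close>

definition ae_class :: "'x measure \<Rightarrow> ('x \<Rightarrow> 'b) set \<Rightarrow> ('x \<Rightarrow> 'b) \<Rightarrow> ('x \<Rightarrow> 'b) set" where
  "ae_class M S v = {w \<in> S. AE x in M. w x = v x}"

definition lift1 ::
  "'x measure \<Rightarrow> ('x \<Rightarrow> 'c) set \<Rightarrow> ('a \<Rightarrow> 'c) \<Rightarrow> ('x \<Rightarrow> 'a) set \<Rightarrow> ('x \<Rightarrow> 'c) set" where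
  "lift1 M S h V = (\<Union>v\<in>V. ae_class M S (\<lambda>x. h (v x)))"

definition lift2 ::
  "'x measure \<Rightarrow> ('x \<Rightarrow> 'c) set \<Rightarrow> ('a \<Rightarrow> 'b \<Rightarrow> 'c) \<Rightarrow>
    ('x \<Rightarrow> 'a) set \<Rightarrow> ('x \<Rightarrow> 'b) set \<Rightarrow> ('x \<Rightarrow> 'c) set" where
  "lift2 M S h V W = (\<Union>v\<in>V. \<Union>w\<in>W. ae_class M S (\<lambda>x. h (v x) (w x)))"

definition quot_Linf :: "'x measure \<Rightarrow> ('x \<Rightarrow> real) set set" where
  "quot_Linf M = ae_class M (Linf M) ` Linf M"

definition quot_Linf_norm :: "'x measure \<Rightarrow> ('x \<Rightarrow> real) set \<Rightarrow> real" where
  "quot_Linf_norm M F = (INF f\<in>F. sup_norm M f)"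

definition quot_LinfB_norm :: "'x measure \<Rightarrow> ('x \<Rightarrow> 'b::real_normed_vector) set \<Rightarrow> real" where
  "quot_LinfB_norm M V = quot_Linf_norm M (lift1 M (Linf M) norm V)"

text \<open>
  Linearity on \<open>D\<close>, a set of classes of elements of \<open>S\<close>, and continuity on \<open>D\<close> from the norm \<open>N\<close>
  to the supremum norm.
\<close>

definition linear_on_classes ::
  "'x measure \<Rightarrow> ('x \<Rightarrow> 'b::real_vector) set \<Rightarrow> ('x \<Rightarrow> 'b) set set \<Rightarrow>
    (('x \<Rightarrow> 'b) set \<Rightarrow> 'x \<Rightarrow> 'c::real_vector) \<Rightarrow> bool" where
  "linear_on_classes M S D L \<longleftrightarrow>
     (\<forall>V\<in>D. \<forall>W\<in>D. \<forall>x\<in>space M. L (lift2 M S (+) V W) x = L V x + L W x) \<and>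
     (\<forall>c. \<forall>V\<in>D. \<forall>x\<in>space M. L (lift1 M S ((*\<^sub>R) c) V) x = c *\<^sub>R L V x)"

definition continuous_on_classes ::
  "'x measure \<Rightarrow> ('x \<Rightarrow> 'b::real_vector) set \<Rightarrow> ('x \<Rightarrow> 'b) set set \<Rightarrow>
    (('x \<Rightarrow> 'b) set \<Rightarrow> real) \<Rightarrow> (('x \<Rightarrow> 'b) set \<Rightarrow> 'x \<Rightarrow> 'c::real_normed_vector) \<Rightarrow> bool" where
  "continuous_on_classes M S D N L \<longleftrightarrow>
     (\<forall>V\<in>D. \<forall>e>0. \<exists>d>0. \<forall>W\<in>D.
        N (lift2 M S (-) W V) < d \<longrightarrow> sup_norm M (\<lambda>x. L W x - L V x) < e)"

text \<open>
  The map on functions induced by a lifting; \<open>\<rightarrow>\<^sub>E\<close> fixes its value outside \<open>quot_Linf M\<close>, so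
  that it is unique as a total function.
\<close>

definition fun_lifting :: "'x measure \<Rightarrow> ('x set \<Rightarrow> 'x set) \<Rightarrow> ('x \<Rightarrow> real) set \<Rightarrow> 'x \<Rightarrow> real" where
  "fun_lifting M l =
     (THE L. L \<in> quot_Linf M \<rightarrow>\<^sub>E Linf M \<and>
        linear_on_classes M (Linf M) (quot_Linf M) L \<and>
        continuous_on_classes M (Linf M) (quot_Linf M) (quot_Linf_norm M) L \<and>
        (\<forall>E\<in>sets M. L (ae_class M (Linf M) (indicat_real E)) = indicat_real (l E)))"

definition canonical_embedding ::
  "'b::real_normed_vector \<Rightarrow> ('b \<Rightarrow>\<^sub>L real) \<Rightarrow>\<^sub>L real" where
  "canonical_embedding b = Blinfun (\<lambda>\<phi>. blinfun_apply \<phi> b)"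

lemma canonical_embedding_apply: "blinfun_apply (canonical_embedding b) \<phi> = blinfun_apply \<phi> b"
  unfolding canonical_embedding_def
  by (simp add: bounded_linear_Blinfun_apply blinfun.bounded_linear_left)

definition banach_bundle :: "'x measure \<Rightarrow> ('x \<Rightarrow> 'b::real_normed_vector set) \<Rightarrow> bool" where
  "banach_bundle M E \<longleftrightarrow>
     (\<forall>x\<in>space M. subspace (E x) \<and> closed (E x)) \<and>
     (\<forall>U. open U \<longrightarrow> {x\<in>space M. E x \<inter> U \<noteq> {}} \<in> sets M)"

definition Gamma_bar ::
  "'x measure \<Rightarrow> ('x \<Rightarrow> 'b::real_normed_vector set) \<Rightarrow> ('x \<Rightarrow> 'b) set" where
  "Gamma_bar M E = {v\<in>LinfB M. \<forall>x\<in>space M. v x \<in> E x}"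

definition Gamma_inf ::
  "'x measure \<Rightarrow> ('x \<Rightarrow> 'b::real_normed_vector set) \<Rightarrow> ('x \<Rightarrow> 'b) set set" where
  "Gamma_inf M E = ae_class M (LinfB M) ` Gamma_bar M E"

text \<open>
  The same definition as the library's \<open>has_bochner_integral\<close>, which is restricted to
  second countable target spaces.
\<close>

definition has_bochner_int ::
  "'x measure \<Rightarrow> ('x \<Rightarrow> 'b::real_normed_vector) \<Rightarrow> 'b \<Rightarrow> bool" where
  "has_bochner_int M v z \<longleftrightarrow>
     v \<in> borel_measurable M \<and>
     (\<exists>s. (\<forall>n. Bochner_Integration.simple_bochner_integrable M (s n)) \<and>
          (\<lambda>n. \<integral>\<^sup>+x. ennreal (norm (v x - s n x)) \<partial>M) \<longlonglongrightarrow> 0 \<and>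
          (\<lambda>n. Bochner_Integration.simple_bochner_integral M (s n)) \<longlonglongrightarrow> z)"

lemma has_bochner_int_iff_has_bochner_integral:
  fixes v :: "'x \<Rightarrow> 'b::{real_normed_vector, second_countable_topology}"
  shows "has_bochner_int M v z \<longleftrightarrow> has_bochner_integral M v z"
  unfolding has_bochner_int_def has_bochner_integral.simps by blast

text \<open>The integral over \<open>I\<close> of (any representative of) the class \<open>V\<close>.\<close>

definition class_integral ::
  "'x measure \<Rightarrow> 'x set \<Rightarrow> ('x \<Rightarrow> 'b::real_normed_vector) set \<Rightarrow> 'b" where
  "class_integral M I V = (THE z. \<exists>v\<in>V. has_bochner_int M (\<lambda>x. indicat_real I x *\<^sub>R v x) z)"

definition lifted_sets :: "'x measure \<Rightarrow> ('x set \<Rightarrow> 'x set) \<Rightarrow> 'x set set" where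
  "lifted_sets M l = {l E |E. E \<in> sets M \<and> 0 < emeasure M E \<and> emeasure M E < \<infinity>}"

definition lifted_sets_at :: "'x measure \<Rightarrow> ('x set \<Rightarrow> 'x set) \<Rightarrow> 'x \<Rightarrow> 'x set set" where
  "lifted_sets_at M l x = {I \<in> lifted_sets M l. x \<in> I}"

definition lifting_limit ::
  "'x measure \<Rightarrow> ('x set \<Rightarrow> 'x set) \<Rightarrow> 'x \<Rightarrow> ('x set \<Rightarrow> 'b::topological_space) \<Rightarrow> 'b \<Rightarrow> bool" where
  "lifting_limit M l x \<Phi> z \<longleftrightarrow>
     lifted_sets_at M l x \<noteq> {} \<and>
     (\<forall>U. open U \<and> z \<in> U \<longrightarrow>
        (\<exists>I\<in>lifted_sets_at M l x. \<forall>J\<in>lifted_sets_at M l x. J \<subseteq> I \<longrightarrow> \<Phi> J \<in> U))"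

definition precise_rep ::
  "'x measure \<Rightarrow> ('x set \<Rightarrow> 'x set) \<Rightarrow> ('x \<Rightarrow> 'b::real_normed_vector set) \<Rightarrow>
    ('x \<Rightarrow> 'b) set \<Rightarrow> 'x \<Rightarrow> 'b" where
  "precise_rep M l E V x =
     (let lim = lifting_limit M l x (\<lambda>I. (1 / measure M I) *\<^sub>R class_integral M I V)
      in if \<exists>z\<in>E x. lim z then THE z. lim z else 0)"

end

theory Submission
  imports Defs
begin

text \<open>
  For \<open>x\<close> in \<open>X\<close>, the sets \<open>E\<close> with \<open>x \<in> l(E)\<close> form an ultrafilter \<open>F\<^sub>x\<close> of the Boolean algebra of
  measurable sets, and \<open>l(f)(x)\<close> is the limit of \<open>f\<close> along \<open>F\<^sub>x\<close>. The lifting of a section \<open>v\<close> is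
  defined weakly, \<open>l(v)(x)(\<phi>) = l(\<phi> \<circ> v)(x)\<close>, so that its algebraic properties and the norm bound are
  properties of limits. A strongly measurable \<open>v\<close> has essentially separable range, hence \<open>v\<close>
  converges to \<open>v(x)\<close> in norm along \<open>F\<^sub>x\<close> for almost every \<open>x\<close>. At such \<open>x\<close> both \<open>l(v)(x) = J(v(x))\<close>
  and the convergence of the averages that define the precise representative follow.
\<close>

text \<open>The bidual appears because a bounded map into an infinite-dimensional space need not
  converge in norm along \<open>lifting_filter x\<close>. Only its compositions with functionals
  always converge, by compactness of bounded intervals, and their limits, as a function of the
  functional, need not come from a point of the space. Applying the a.e. identity for scalar
  functions to each functional separately would produce uncountably many null sets; norm convergence
  yields a single null set for all functionals. The target may be non-separable, so sums of Borel
  maps need not be Borel: measurability is obtained from approximating simple maps, and completeness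
  of the measure absorbs changes on null sets. Sigma-finiteness puts almost every point into the
  lifting of a set of finite measure, so that the averages of the precise representative have sets
  to run over. Since \<open>fun_lifting\<close>, \<open>class_integral\<close> and the limit in
  \<open>precise_rep\<close> are definite descriptions, existence and uniqueness of the described
  object come before any use of them.\<close>

section \<open>Measurability up to null sets, and simple maps\<close>

text \<open>Preimages under \<open>f\<close> and \<open>g\<close> differ by a null set, which
  completeness makes harmless. Functions defined by limits along a filter get their measurability
  this way.\<close>

lemma (in complete_measure) borel_measurable_AE_cong:
  fixes f g :: "'a \<Rightarrow> 'b::topological_space"
  assumes f: "f \<in> borel_measurable M" and eq: "AE x in M. g x = f x"
  shows "g \<in> borel_measurable M"
proof (rule borel_measurableI)
  fix S :: "'b set" assume "open S"
  then have "f -` S \<inter> space M \<in> sets M"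
    using f by (auto intro: measurable_sets)
  moreover have "AE x in M. x \<in> f -` S \<inter> space M \<longleftrightarrow> x \<in> g -` S \<inter> space M"
    using eq by eventually_elim auto
  ultimately show "g -` S \<inter> space M \<in> sets M"
    by (intro in_sets_AE[of "f -` S \<inter> space M" "g -` S \<inter> space M"]) auto
qed

abbreviation simple_integrable :: "'a measure \<Rightarrow> ('a \<Rightarrow> 'b::real_vector) \<Rightarrow> bool" where
  "simple_integrable \<equiv> Bochner_Integration.simple_bochner_integrable"

abbreviation simple_integral :: "'a measure \<Rightarrow> ('a \<Rightarrow> 'b::real_vector) \<Rightarrow> 'b" where
  "simple_integral \<equiv> Bochner_Integration.simple_bochner_integral"

lemma simple_integrable_measurable:
  fixes s :: "'a \<Rightarrow> 'b::real_normed_vector"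
  assumes "simple_integrable M s"
  shows "s \<in> borel_measurable M"
  using assms by (auto elim!: Bochner_Integration.simple_bochner_integrable.cases
      intro: borel_measurable_simple_function)

lemma simple_integrable_scaleR:
  fixes s :: "'a \<Rightarrow> 'b::real_vector"
  assumes s: "simple_integrable M s" and f: "simple_function M f"
  shows "simple_integrable M (\<lambda>x. f x *\<^sub>R s x)"
proof -
  have s': "simple_function M s" "emeasure M {y \<in> space M. s y \<noteq> 0} \<noteq> \<infinity>"
    using s by (auto elim: Bochner_Integration.simple_bochner_integrable.cases)
  show ?thesis
  proof (rule Bochner_Integration.simple_bochner_integrable.intros)
    show "simple_function M (\<lambda>x. f x *\<^sub>R s x)"
      by (rule simple_function_compose2[OF f s'(1)])
    have "{y \<in> space M. s y \<noteq> 0} \<in> sets M"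
      using simple_functionD(2)[OF s'(1), of "-{0}"] by (auto simp: vimage_def Int_def conj_commute)
    then have "emeasure M {y \<in> space M. f y *\<^sub>R s y \<noteq> 0} \<le> emeasure M {y \<in> space M. s y \<noteq> 0}"
      by (intro emeasure_mono) auto
    with s'(2) show "emeasure M {y \<in> space M. f y *\<^sub>R s y \<noteq> 0} \<noteq> \<infinity>"
      by (auto simp: top_unique)
  qed
qed

lemma simple_integrable_indicator:
  assumes "A \<in> sets M" "emeasure M A \<noteq> \<infinity>"
  shows "simple_integrable M (\<lambda>x. indicat_real A x *\<^sub>R b)"
proof (rule Bochner_Integration.simple_bochner_integrable.intros)
  show "simple_function M (\<lambda>x. indicat_real A x *\<^sub>R b)"
    by (rule simple_function_compose1) (simp add: simple_function_indicator assms)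
  have "emeasure M {y \<in> space M. indicat_real A y *\<^sub>R b \<noteq> 0} \<le> emeasure M A"
    using assms(1) by (intro emeasure_mono) (auto simp: indicator_def split: if_splits)
  with assms(2) show "emeasure M {y \<in> space M. indicat_real A y *\<^sub>R b \<noteq> 0} \<noteq> \<infinity>"
    by (auto simp: top_unique)
qed

lemma simple_integral_indicator:
  fixes b :: "'b::real_vector"
  assumes "A \<in> sets M" "emeasure M A \<noteq> \<infinity>"
  shows "simple_integral M (\<lambda>x. indicat_real A x *\<^sub>R b) = measure M A *\<^sub>R b"
proof -
  have A: "{x \<in> space M. indicat_real A x = 1} = A"
    using sets.sets_into_space[OF assms(1)] by (auto simp: indicator_def split: if_splits)
  have "simple_integral M (\<lambda>x. indicat_real A x *\<^sub>R b) =
      (\<Sum>y\<in>indicat_real A ` space M. measure M {x\<in>space M. indicat_real A x = y} *\<^sub>R (y *\<^sub>R b))"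
    using assms by (intro Bochner_Integration.simple_bochner_integral_partition
        simple_integrable_indicator simple_function_indicator) auto
  \<comment> \<open>The value 0 contributes nothing; if 1 is not attained, its level set is empty
    and has measure 0.\<close>
  also have "\<dots> = (\<Sum>y\<in>{1}. measure M {x\<in>space M. indicat_real A x = y} *\<^sub>R (y *\<^sub>R b))"
  proof (rule sum.mono_neutral_cong)
    show "finite (indicat_real A ` space M)"
      by (rule finite_subset[of _ "{0, 1}"]) (auto simp: indicator_def)
    fix y assume "y \<in> {1} - indicat_real A ` space M"
    then have "{x\<in>space M. indicat_real A x = y} = {}" by auto
    then show "measure M {x\<in>space M. indicat_real A x = y} *\<^sub>R (y *\<^sub>R b) = 0"
      by (simp only: measure_empty scaleR_zero_left)
  qed (auto simp: indicator_def)
  finally show ?thesis by (simp add: A)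
qed

lemma simple_integrable_diff:
  assumes "simple_integrable M s" "simple_integrable M t"
  shows "simple_integrable M (\<lambda>x. s x - t x)"
  using Bochner_Integration.simple_bochner_integrable_compose2[of "(-)", OF _ assms] by simp

text \<open>The bridge from L1 distances of simple maps to distances of their integrals, used both
  for comparing two integrals and for the Cauchy property behind existence.\<close>

lemma simple_integral_norm_diff_le:
  fixes s t :: "'a \<Rightarrow> 'b::real_normed_vector"
  assumes s: "simple_integrable M s" and t: "simple_integrable M t"
  shows "ennreal (norm (simple_integral M s - simple_integral M t)) \<le>
    (\<integral>\<^sup>+x. ennreal (norm (s x - t x)) \<partial>M)"
proof -
  have st: "simple_integrable M (\<lambda>x. s x - t x)"
    by (rule simple_integrable_diff[OF s t])
  have n: "simple_integrable M (\<lambda>x. norm (s x - t x))"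
    using Bochner_Integration.simple_bochner_integrable_compose2[of "\<lambda>x y. norm x", OF _ st st] by simp
  have "norm (simple_integral M s - simple_integral M t) \<le> simple_integral M (\<lambda>x. norm (s x - t x))"
    using Bochner_Integration.simple_bochner_integral_norm_bound[OF st]
    by (simp add: Bochner_Integration.simple_bochner_integral_diff[OF s t])
  then show ?thesis
    by (simp flip: Bochner_Integration.simple_bochner_integral_eq_nn_integral[OF n])
qed

subsection \<open>Strong measurability over a complete measure\<close>

text \<open>Over a complete measure, measurability of \<open>v\<close> follows from the a.e.
  approximation, so only the latter has to be checked.\<close>

lemma (in complete_measure) strongly_measurableI:
  fixes v :: "'a \<Rightarrow> 'b::real_normed_vector"
  assumes s: "\<And>n. simple_integrable M (s n)" and lim: "AE x in M. (\<lambda>n. s n x) \<longlonglongrightarrow> v x"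
  shows "strongly_measurable M v"
proof -
  obtain N where N: "N \<in> null_sets M" "{x \<in> space M. \<not> (\<lambda>n. s n x) \<longlonglongrightarrow> v x} \<subseteq> N"
    using lim by (auto simp: eventually_ae_filter)
  \<comment> \<open>Approximants and limit are both set to 0 on \<open>N\<close>, so that
    convergence holds at every point of the space.\<close>
  define w where "w x = (if x \<in> N then 0 else v x)" for x
  have NM: "N \<in> sets M" using N by auto
  have "w \<in> borel_measurable M"
  proof (rule borel_measurable_LIMSEQ_metric)
    fix n
    show "(\<lambda>x. if x \<in> N then 0 else s n x) \<in> borel_measurable M"
      using NM simple_integrable_measurable[OF s[of n]] by measurable
  next
    fix x assume "x \<in> space M"
    with N(2) show "(\<lambda>n. if x \<in> N then 0 else s n x) \<longlonglongrightarrow> w x"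
      by (auto simp: w_def)
  qed
  moreover have "AE x in M. v x = w x"
    using AE_not_in[OF N(1)] by eventually_elim (simp add: w_def)
  ultimately have "v \<in> borel_measurable M"
    by (rule borel_measurable_AE_cong)
  with s lim show ?thesis
    by (auto simp: strongly_measurable_def)
qed

lemma strongly_measurableE:
  assumes "strongly_measurable M v"
  obtains s where "\<And>n. simple_integrable M (s n)" "AE x in M. (\<lambda>n. s n x) \<longlonglongrightarrow> v x"
  using assms by (auto simp: strongly_measurable_def)

lemma (in complete_measure) strongly_measurable_AE_cong:
  fixes v w :: "'a \<Rightarrow> 'b::real_normed_vector"
  assumes v: "strongly_measurable M v" and eq: "AE x in M. w x = v x"
  shows "strongly_measurable M w"
proof -
  obtain s where s: "\<And>n. simple_integrable M (s n)" and "AE x in M. (\<lambda>n. s n x) \<longlonglongrightarrow> v x"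
    using v by (rule strongly_measurableE) blast
  from this(2) eq have "AE x in M. (\<lambda>n. s n x) \<longlonglongrightarrow> w x"
    by eventually_elim simp
  with s show ?thesis by (rule strongly_measurableI)
qed

text \<open>A pair of Borel maps into non-separable spaces need not be Borel for the product
  topology, so \<open>h\<close> is applied to the simple approximants. The condition
  \<open>h 0 0 = 0\<close> keeps the support of the composed map inside the union of the two
  supports, which has finite measure.\<close>

lemma (in complete_measure) strongly_measurable_compose2:
  fixes v :: "'a \<Rightarrow> 'b::real_normed_vector" and w :: "'a \<Rightarrow> 'c::real_normed_vector"
    and h :: "'b \<Rightarrow> 'c \<Rightarrow> 'd::real_normed_vector"
  assumes v: "strongly_measurable M v" and w: "strongly_measurable M w" and "h 0 0 = 0"
    and h: "continuous_on UNIV (\<lambda>p. h (fst p) (snd p))"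
  shows "strongly_measurable M (\<lambda>x. h (v x) (w x))"
proof -
  obtain s where s: "\<And>n. simple_integrable M (s n)" and ls: "AE x in M. (\<lambda>n. s n x) \<longlonglongrightarrow> v x"
    using v by (rule strongly_measurableE) blast
  obtain t where t: "\<And>n. simple_integrable M (t n)" and lt: "AE x in M. (\<lambda>n. t n x) \<longlonglongrightarrow> w x"
    using w by (rule strongly_measurableE) blast
  have "simple_integrable M (\<lambda>x. h (s n x) (t n x))" for n
  proof -
    have sf: "simple_function M (s n)" "emeasure M {y \<in> space M. s n y \<noteq> 0} \<noteq> \<infinity>"
      "simple_function M (t n)" "emeasure M {y \<in> space M. t n y \<noteq> 0} \<noteq> \<infinity>"
      using s[of n] t[of n] by (auto elim: Bochner_Integration.simple_bochner_integrable.cases)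
    have S: "{y \<in> space M. s n y \<noteq> 0} \<in> sets M" "{y \<in> space M. t n y \<noteq> 0} \<in> sets M"
      using simple_functionD(2)[OF sf(1), of "-{0}"] simple_functionD(2)[OF sf(3), of "-{0}"]
      by (auto simp: vimage_def Int_def conj_commute)
    show ?thesis
    proof (rule Bochner_Integration.simple_bochner_integrable.intros)
      show "simple_function M (\<lambda>x. h (s n x) (t n x))"
        by (rule simple_function_compose2[OF sf(1,3)])
      have "emeasure M {y \<in> space M. h (s n y) (t n y) \<noteq> 0} \<le>
          emeasure M ({y \<in> space M. s n y \<noteq> 0} \<union> {y \<in> space M. t n y \<noteq> 0})"
        using \<open>h 0 0 = 0\<close> S by (intro emeasure_mono) auto
      also have "\<dots> \<le> emeasure M {y \<in> space M. s n y \<noteq> 0} + emeasure M {y \<in> space M. t n y \<noteq> 0}"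
        by (rule emeasure_subadditive[OF S])
      also have "\<dots> < \<infinity>"
        using sf by (auto simp: less_top)
      finally show "emeasure M {y \<in> space M. h (s n y) (t n y) \<noteq> 0} \<noteq> \<infinity>"
        by auto
    qed
  qed
  moreover have "AE x in M. (\<lambda>n. h (s n x) (t n x)) \<longlonglongrightarrow> h (v x) (w x)"
    using ls lt
  proof eventually_elim
    case (elim x)
    then have "(\<lambda>n. (s n x, t n x)) \<longlonglongrightarrow> (v x, w x)"
      by (rule tendsto_Pair)
    then show ?case
      using continuous_on_tendsto_compose[OF h, of "\<lambda>n. (s n x, t n x)" "(v x, w x)" sequentially]
      by simp
  qed
  ultimately show ?thesis by (rule strongly_measurableI)
qed

text \<open>The approximants of \<open>v\<close> already have supports of finite measure, so the
  simple functions approximating \<open>f\<close> need not.\<close>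

lemma (in complete_measure) strongly_measurable_scaleR:
  fixes v :: "'a \<Rightarrow> 'b::real_normed_vector"
  assumes v: "strongly_measurable M v" and f: "f \<in> borel_measurable M"
  shows "strongly_measurable M (\<lambda>x. f x *\<^sub>R v x)"
proof -
  obtain s where s: "\<And>n. simple_integrable M (s n)" and ls: "AE x in M. (\<lambda>n. s n x) \<longlonglongrightarrow> v x"
    using v by (rule strongly_measurableE) blast
  obtain g :: "nat \<Rightarrow> 'a \<Rightarrow> real" where g: "\<And>n. simple_function M (g n)"
      "\<And>x. x \<in> space M \<Longrightarrow> (\<lambda>n. g n x) \<longlonglongrightarrow> f x"
    using borel_measurable_implies_sequence_metric[OF f, of 0] by blast
  have "AE x in M. (\<lambda>n. g n x *\<^sub>R s n x) \<longlonglongrightarrow> f x *\<^sub>R v x"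
    using ls AE_space by eventually_elim (intro tendsto_scaleR g)
  with simple_integrable_scaleR[OF s g(1)] show ?thesis
    by (rule strongly_measurableI)
qed

text \<open>On a space of infinite measure a nonzero constant is not a simple integrable map; cut
  off along an exhaustion by sets of finite measure, it gives approximants that at each point are
  eventually equal to it.\<close>

lemma strongly_measurable_const:
  fixes b :: "'b::real_normed_vector"
  assumes "complete_measure M" "sigma_finite_measure M"
  shows "strongly_measurable M (\<lambda>x. b)"
proof -
  interpret complete_measure M by fact
  interpret sigma_finite_measure M by fact
  obtain A :: "nat \<Rightarrow> 'a set" where A: "range A \<subseteq> sets M" "(\<Union>i. A i) = space M"
      "\<And>i. emeasure M (A i) \<noteq> \<infinity>" "incseq A"
    by (rule sigma_finite_incseq) blast
  have "(\<lambda>n. indicat_real (A n) x *\<^sub>R b) \<longlonglongrightarrow> b" if "x \<in> space M" for x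
  proof -
    obtain i where "x \<in> A i" using \<open>x \<in> space M\<close> A(2) by blast
    then have "\<forall>n\<ge>i. x \<in> A n" using incseqD[OF A(4)] by blast
    then have "\<forall>\<^sub>F n in sequentially. b = indicat_real (A n) x *\<^sub>R b"
      unfolding eventually_sequentially by (intro exI[of _ i]) simp
    then show ?thesis
      by (rule Lim_transform_eventually[OF tendsto_const])
  qed
  then have "AE x in M. (\<lambda>n. indicat_real (A n) x *\<^sub>R b) \<longlonglongrightarrow> b" by simp
  moreover have "simple_integrable M (\<lambda>x. indicat_real (A n) x *\<^sub>R b)" for n
    using A by (intro simple_integrable_indicator) auto
  ultimately show ?thesis by (rule strongly_measurableI[rotated])
qed

text \<open>Countably many maps with finitely many values have countably many values. This essential
  separability lets countably many sets control the convergence of \<open>v\<close> along the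
  filters.\<close>

lemma strongly_measurable_separable:
  assumes "strongly_measurable M v"
  obtains D where "countable D" "AE x in M. v x \<in> closure D"
proof -
  obtain s where s: "\<And>n. simple_integrable M (s n)" and ls: "AE x in M. (\<lambda>n. s n x) \<longlonglongrightarrow> v x"
    using assms by (rule strongly_measurableE) blast
  define D where "D = (\<Union>n. s n ` space M)"
  have "finite (s n ` space M)" for n
    using s[of n] by (auto elim!: Bochner_Integration.simple_bochner_integrable.cases dest: simple_functionD)
  then have "countable D" unfolding D_def
    by (intro countable_UN) (auto intro: countable_finite)
  moreover have "AE x in M. v x \<in> closure D"
    using ls AE_space
  proof eventually_elim
    case (elim x)
    have "\<forall>n. s n x \<in> D" using elim(2) by (auto simp: D_def)
    with elim(1) show ?case by (auto simp: closure_sequential)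
  qed
  ultimately show ?thesis by (rule that)
qed

subsection \<open>The Bochner integral\<close>

text \<open>One estimate with two uses: \<open>g = 0\<close> gives uniqueness of the integral, and a
  multiple of an indicator bounds the distance of an average from a fixed vector.\<close>

lemma has_bochner_int_norm_diff_le:
  fixes v w :: "'a \<Rightarrow> 'b::real_normed_vector"
  assumes v: "has_bochner_int M v y" and w: "has_bochner_int M w z"
    and le: "AE x in M. ennreal (norm (v x - w x)) \<le> g x" and g: "g \<in> borel_measurable M"
  shows "ennreal (norm (y - z)) \<le> (\<integral>\<^sup>+x. g x \<partial>M)"
proof -
  \<comment> \<open>\<open>r\<close> has finitely many values, and on each of its level sets
    \<open>u - r\<close> is a translate of \<open>u\<close> by a constant; this gives measurability
    without separability.\<close>
  have diff: "(\<lambda>x. u x - r x) \<in> borel_measurable M"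
    if "u \<in> borel_measurable M" "simple_integrable M r" for u r :: "'a \<Rightarrow> 'b"
  proof (rule borel_measurableI)
    fix S :: "'b set" assume "open S"
    have r: "simple_function M r"
      using that by (auto elim: Bochner_Integration.simple_bochner_integrable.cases)
    have "open ((\<lambda>x. x - b) -` S)" for b
      using \<open>open S\<close> by (intro open_vimage continuous_intros)
    then have "(r -` {b} \<inter> space M) \<inter> (u -` ((\<lambda>x. x - b) -` S) \<inter> space M) \<in> sets M" for b
      using that r by (intro sets.Int measurable_sets[OF that(1)] simple_functionD(2)) auto
    moreover have "(\<lambda>x. u x - r x) -` S \<inter> space M =
        (\<Union>b\<in>r ` space M. (r -` {b} \<inter> space M) \<inter> (u -` ((\<lambda>x. x - b) -` S) \<inter> space M))"
      by auto
    ultimately show "(\<lambda>x. u x - r x) -` S \<inter> space M \<in> sets M"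
      using simple_functionD(1)[OF r] by (simp only: sets.finite_UN)
  qed
  from v obtain s where s: "\<And>n. simple_integrable M (s n)"
      "(\<lambda>n. \<integral>\<^sup>+x. ennreal (norm (v x - s n x)) \<partial>M) \<longlonglongrightarrow> 0" "(\<lambda>n. simple_integral M (s n)) \<longlonglongrightarrow> y"
      and [measurable]: "v \<in> borel_measurable M"
    by (auto simp: has_bochner_int_def)
  from w obtain t where t: "\<And>n. simple_integrable M (t n)"
      "(\<lambda>n. \<integral>\<^sup>+x. ennreal (norm (w x - t n x)) \<partial>M) \<longlonglongrightarrow> 0" "(\<lambda>n. simple_integral M (t n)) \<longlonglongrightarrow> z"
      and [measurable]: "w \<in> borel_measurable M"
    by (auto simp: has_bochner_int_def)
  have [measurable]: "(\<lambda>x. v x - s n x) \<in> borel_measurable M"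
    "(\<lambda>x. w x - t n x) \<in> borel_measurable M" for n
    using s(1) t(1) by (auto intro: diff)
  note g[measurable]
  have "ennreal (norm (simple_integral M (s n) - simple_integral M (t n))) \<le>
      (\<integral>\<^sup>+x. ennreal (norm (v x - s n x)) \<partial>M) + (\<integral>\<^sup>+x. ennreal (norm (w x - t n x)) \<partial>M) + (\<integral>\<^sup>+x. g x \<partial>M)" for n
  proof -
    have "ennreal (norm (simple_integral M (s n) - simple_integral M (t n))) \<le>
        (\<integral>\<^sup>+x. ennreal (norm (s n x - t n x)) \<partial>M)"
      by (rule simple_integral_norm_diff_le[OF s(1) t(1)])
    also have "\<dots> \<le> (\<integral>\<^sup>+x. ennreal (norm (v x - s n x)) + ennreal (norm (w x - t n x)) + g x \<partial>M)"
    proof (rule nn_integral_mono_AE, use le in eventually_elim)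
      case (elim x)
      \<comment> \<open>Uses
        \<open>s n x - t n x = (v x - w x) + (w x - t n x) - (v x - s n x)\<close>.\<close>
      have "norm (s n x - t n x) \<le> norm (v x - s n x) + norm (w x - t n x) + norm (v x - w x)"
        using norm_triangle_ineq4[of "(v x - w x) + (w x - t n x)" "v x - s n x"]
          norm_triangle_ineq[of "v x - w x" "w x - t n x"] by (simp add: algebra_simps)
      then have "ennreal (norm (s n x - t n x)) \<le>
          ennreal (norm (v x - s n x)) + ennreal (norm (w x - t n x)) + ennreal (norm (v x - w x))"
        by (simp flip: ennreal_plus)
      also have "\<dots> \<le> ennreal (norm (v x - s n x)) + ennreal (norm (w x - t n x)) + g x"
        using elim by (intro add_mono) auto
      finally show ?case .
    qed
    also have "\<dots> = (\<integral>\<^sup>+x. ennreal (norm (v x - s n x)) \<partial>M) +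
        (\<integral>\<^sup>+x. ennreal (norm (w x - t n x)) \<partial>M) + (\<integral>\<^sup>+x. g x \<partial>M)"
      by (simp add: nn_integral_add)
    finally show ?thesis .
  qed
  moreover have "(\<lambda>n. (\<integral>\<^sup>+x. ennreal (norm (v x - s n x)) \<partial>M) +
      (\<integral>\<^sup>+x. ennreal (norm (w x - t n x)) \<partial>M) + (\<integral>\<^sup>+x. g x \<partial>M)) \<longlonglongrightarrow> 0 + 0 + (\<integral>\<^sup>+x. g x \<partial>M)"
    by (intro tendsto_add s t tendsto_const)
  moreover have "(\<lambda>n. ennreal (norm (simple_integral M (s n) - simple_integral M (t n)))) \<longlonglongrightarrow>
      ennreal (norm (y - z))"
    by (intro tendsto_ennrealI tendsto_norm tendsto_diff s t)
  ultimately show ?thesis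
    by (auto intro: LIMSEQ_le)
qed

lemma has_bochner_int_unique_AE:
  fixes v w :: "'a \<Rightarrow> 'b::real_normed_vector"
  assumes "has_bochner_int M v y" "has_bochner_int M w z" "AE x in M. v x = w x"
  shows "y = z"
proof -
  have "ennreal (norm (y - z)) \<le> (\<integral>\<^sup>+x. 0 \<partial>M)"
    using assms by (intro has_bochner_int_norm_diff_le[OF assms(1,2)]) auto
  then show ?thesis by (simp add: ennreal_le_iff2)
qed

lemma has_bochner_int_indicator:
  fixes b :: "'b::real_normed_vector"
  assumes "A \<in> sets M" "emeasure M A \<noteq> \<infinity>"
  shows "has_bochner_int M (\<lambda>x. indicat_real A x *\<^sub>R b) (measure M A *\<^sub>R b)"
  unfolding has_bochner_int_def
  using simple_integrable_indicator[OF assms, of b] simple_integral_indicator[OF assms, of b]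
  by (auto intro!: exI[of _ "\<lambda>n x. indicat_real A x *\<^sub>R b"] simple_integrable_measurable)

text \<open>Truncated approximants have a common integrable bound, so dominated convergence turns
  a.e. convergence into L1 convergence. The integrals of the simple maps are then Cauchy, and
  completeness of the target supplies the limit.\<close>

lemma (in complete_measure) has_bochner_int_exists:
  fixes v :: "'a \<Rightarrow> 'b::banach"
  assumes v: "strongly_measurable M v" and A: "A \<in> sets M" "emeasure M A \<noteq> \<infinity>"
    and C: "\<And>x. x \<in> A \<Longrightarrow> norm (v x) \<le> C"
  shows "\<exists>z. has_bochner_int M (\<lambda>x. indicat_real A x *\<^sub>R v x) z"
proof -
  obtain s where s: "\<And>n. simple_integrable M (s n)" and ls: "AE x in M. (\<lambda>n. s n x) \<longlonglongrightarrow> v x"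
    using v by (rule strongly_measurableE) blast
  let ?v = "\<lambda>x. indicat_real A x *\<^sub>R v x"
  have v': "strongly_measurable M ?v"
    by (rule strongly_measurable_scaleR[OF v]) (use A in measurable)
  \<comment> \<open>With level \<open>C + 1\<close>, the inequality
    \<open>norm (v x) < C + 1\<close> is strict on \<open>A\<close>, so the truncation is eventually
    inactive wherever \<open>s n x\<close> converges to \<open>v x\<close>.\<close>
  define t where "t n x = indicat_real A x *\<^sub>R (if norm (s n x) \<le> C + 1 then s n x else 0)" for n x
  have t: "simple_integrable M (t n)" for n
    unfolding t_def using s[of n] A(1)
    by (intro simple_integrable_scaleR simple_function_indicator
        Bochner_Integration.simple_bochner_integrable_compose2
          [of "\<lambda>x y. if norm x \<le> C + 1 then x else 0"]) auto
  have lt: "AE x in M. (\<lambda>n. t n x) \<longlonglongrightarrow> ?v x"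
    using ls
  proof eventually_elim
    case (elim x)
    show ?case
    proof (cases "x \<in> A")
      case True
      then have "norm (v x) < C + 1" using C[of x] by simp
      with tendsto_norm[OF elim] have "\<forall>\<^sub>F n in sequentially. norm (s n x) < C + 1"
        by (rule order_tendstoD)
      then have "\<forall>\<^sub>F n in sequentially. s n x = t n x"
        by eventually_elim (simp add: t_def True)
      with elim show ?thesis
        by (simp add: True Lim_transform_eventually)
    qed (simp add: t_def)
  qed
  have m: "(\<lambda>x. ennreal (norm (?v x - t n x))) \<in> borel_measurable M" for n
  proof -
    have "strongly_measurable M (t n)"
      by (rule strongly_measurableI[of "\<lambda>_. t n"]) (simp_all add: t)
    from strongly_measurable_compose2[OF v' this, of "(-)"]
    have "(\<lambda>x. ?v x - t n x) \<in> borel_measurable M"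
      by (simp add: strongly_measurable_def continuous_intros)
    then show ?thesis by measurable
  qed
  have "(\<lambda>n. \<integral>\<^sup>+x. ennreal (norm (?v x - t n x)) \<partial>M) \<longlonglongrightarrow> (\<integral>\<^sup>+x. 0 \<partial>M)"
  proof (rule nn_integral_dominated_convergence[where w="\<lambda>x. ennreal (2 * \<bar>C\<bar> + 1) * indicator A x"])
    show "(\<lambda>x. ennreal (norm (?v x - t n x))) \<in> borel_measurable M" for n
      by (rule m)
    \<comment> \<open>The bound is the absolute value of \<open>C\<close> for \<open>v\<close> plus
      that value and 1 for \<open>t n\<close>; \<open>C\<close> itself may be negative when
      \<open>A\<close> is empty.\<close>
    show "AE x in M. ennreal (norm (?v x - t n x)) \<le> ennreal (2 * \<bar>C\<bar> + 1) * indicator A x" for n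
    proof (rule AE_I2)
      fix x
      have "norm (?v x - t n x) \<le> 2 * \<bar>C\<bar> + 1" if "x \<in> A"
      proof -
        have "norm (t n x) \<le> \<bar>C\<bar> + 1" by (auto simp: t_def that)
        with C[OF that] norm_triangle_ineq4[of "v x" "t n x"] that show ?thesis by simp
      qed
      then show "ennreal (norm (?v x - t n x)) \<le> ennreal (2 * \<bar>C\<bar> + 1) * indicator A x"
        by (cases "x \<in> A") (auto intro: ennreal_leI simp: t_def simp del: ennreal_plus)
    qed
    show "(\<integral>\<^sup>+x. ennreal (2 * \<bar>C\<bar> + 1) * indicator A x \<partial>M) < \<infinity>"
      using A by (simp add: nn_integral_cmult_indicator ennreal_mult_less_top less_top)
    show "AE x in M. (\<lambda>n. ennreal (norm (?v x - t n x))) \<longlonglongrightarrow> 0"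
      using lt
    proof eventually_elim
      case (elim x)
      have "(\<lambda>n. ennreal (norm (?v x - t n x))) \<longlonglongrightarrow> ennreal (norm (?v x - ?v x))"
        by (intro tendsto_ennrealI tendsto_norm tendsto_diff tendsto_const elim)
      then show ?case by simp
    qed
  qed (use A in simp_all)
  then have lim0: "(\<lambda>n. \<integral>\<^sup>+x. ennreal (norm (?v x - t n x)) \<partial>M) \<longlonglongrightarrow> 0" by simp
  have "Cauchy (\<lambda>n. simple_integral M (t n))"
  proof (rule metric_CauchyI)
    fix e :: real assume "e > 0"
    then have "\<forall>\<^sub>F n in sequentially. (\<integral>\<^sup>+x. ennreal (norm (?v x - t n x)) \<partial>M) < ennreal (e / 2)"
      using order_tendstoD(2)[OF lim0, of "ennreal (e/2)"] by simp
    then obtain N where N: "\<And>n. n \<ge> N \<Longrightarrow> (\<integral>\<^sup>+x. ennreal (norm (?v x - t n x)) \<partial>M) < ennreal (e / 2)"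
      by (auto simp: eventually_sequentially)
    have "dist (simple_integral M (t n)) (simple_integral M (t k)) < e" if "n \<ge> N" "k \<ge> N" for n k
    proof -
      have "ennreal (norm (simple_integral M (t n) - simple_integral M (t k))) \<le>
          (\<integral>\<^sup>+x. ennreal (norm (t n x - t k x)) \<partial>M)"
        by (rule simple_integral_norm_diff_le[OF t t])
      also have "\<dots> \<le> (\<integral>\<^sup>+x. ennreal (norm (?v x - t n x)) + ennreal (norm (?v x - t k x)) \<partial>M)"
      proof (rule nn_integral_mono)
        fix x
        have "norm (t n x - t k x) \<le> norm (?v x - t n x) + norm (?v x - t k x)"
          using norm_triangle_ineq4[of "?v x - t k x" "?v x - t n x"] by (simp add: algebra_simps)
        then show "ennreal (norm (t n x - t k x)) \<le>
            ennreal (norm (?v x - t n x)) + ennreal (norm (?v x - t k x))"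
          by (simp flip: ennreal_plus)
      qed
      also have "\<dots> = (\<integral>\<^sup>+x. ennreal (norm (?v x - t n x)) \<partial>M) + (\<integral>\<^sup>+x. ennreal (norm (?v x - t k x)) \<partial>M)"
        by (intro nn_integral_add m)
      also have "\<dots> < ennreal (e / 2) + ennreal (e / 2)"
        by (intro add_strict_mono N that)
      also have "\<dots> = ennreal e"
        using \<open>e > 0\<close> by (simp flip: ennreal_plus)
      finally show ?thesis
        using \<open>e > 0\<close> by (simp add: dist_norm ennreal_less_iff)
    qed
    then show "\<exists>N. \<forall>n\<ge>N. \<forall>k\<ge>N. dist (simple_integral M (t n)) (simple_integral M (t k)) < e"
      by blast
  qed
  then obtain z where "(\<lambda>n. simple_integral M (t n)) \<longlonglongrightarrow> z"
    by (auto simp: Cauchy_convergent_iff convergent_def)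
  with t lim0 v' have "has_bochner_int M ?v z"
    by (auto simp: has_bochner_int_def strongly_measurable_def intro!: exI[of _ t])
  then show ?thesis ..
qed

subsection \<open>Classes up to a.e. equality\<close>

lemma ae_class_cong:
  assumes "AE x in M. v x = w x"
  shows "ae_class M S v = ae_class M S w"
proof -
  have "(AE x in M. u x = v x) \<longleftrightarrow> (AE x in M. u x = w x)" for u
  proof
    assume "AE x in M. u x = v x" then show "AE x in M. u x = w x"
      using assms by eventually_elim simp
  next
    assume "AE x in M. u x = w x" then show "AE x in M. u x = v x"
      using assms by eventually_elim simp
  qed
  then show ?thesis by (auto simp: ae_class_def)
qed

lemma ae_class_self: "v \<in> S \<Longrightarrow> v \<in> ae_class M S v"
  by (simp add: ae_class_def)

text \<open>All representatives in the union give the same class, and the union is not empty because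
  \<open>v\<close> lies in its own class. The same reasoning serves for
  \<open>lift2\<close>.\<close>

lemma lift1_ae_class:
  assumes "v \<in> S"
  shows "lift1 M S' h (ae_class M S v) = ae_class M S' (\<lambda>x. h (v x))"
proof -
  have "ae_class M S' (\<lambda>x. h (u x)) = ae_class M S' (\<lambda>x. h (v x))" if "u \<in> ae_class M S v" for u
  proof (rule ae_class_cong)
    have "AE x in M. u x = v x" using that by (simp add: ae_class_def)
    then show "AE x in M. h (u x) = h (v x)" by eventually_elim simp
  qed
  with ae_class_self[OF assms, of M] show ?thesis
    unfolding lift1_def by blast
qed

lemma lift2_ae_class:
  assumes "v \<in> S" "w \<in> S'"
  shows "lift2 M S'' h (ae_class M S v) (ae_class M S' w) = ae_class M S'' (\<lambda>x. h (v x) (w x))"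
proof -
  have *: "ae_class M S'' (\<lambda>x. h (u x) (t x)) = ae_class M S'' (\<lambda>x. h (v x) (w x))"
    if "u \<in> ae_class M S v" "t \<in> ae_class M S' w" for u t
  proof (rule ae_class_cong)
    have "AE x in M. u x = v x" "AE x in M. t x = w x"
      using that by (auto simp: ae_class_def)
    then show "AE x in M. h (u x) (t x) = h (v x) (w x)"
      by eventually_elim simp
  qed
  show ?thesis
    using ae_class_self[OF assms(1), of M] ae_class_self[OF assms(2), of M] *
    unfolding lift2_def by blast
qed

subsection \<open>Bounded functions\<close>

lemma LinfI:
  assumes "f \<in> borel_measurable M" "\<And>x. x \<in> space M \<Longrightarrow> \<bar>f x\<bar> \<le> C" "\<And>x. x \<notin> space M \<Longrightarrow> f x = 0"
  shows "f \<in> Linf M"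
  using assms by (auto simp: Linf_def bounded_iff)

lemma Linf_measurable: "f \<in> Linf M \<Longrightarrow> f \<in> borel_measurable M"
  by (simp add: Linf_def)

lemma Linf_outside: "f \<in> Linf M \<Longrightarrow> x \<notin> space M \<Longrightarrow> f x = 0"
  by (simp add: Linf_def)

lemma Linf_bounded:
  assumes "f \<in> Linf M"
  shows "\<exists>C. \<forall>x. \<bar>f x\<bar> \<le> C"
proof -
  from assms obtain C where "\<And>x. x \<in> space M \<Longrightarrow> \<bar>f x\<bar> \<le> C"
    by (auto simp: Linf_def bounded_iff)
  then have "\<bar>f x\<bar> \<le> \<bar>C\<bar>" for x
    using Linf_outside[OF assms, of x] by (cases "x \<in> space M") (auto intro: order_trans[OF _ abs_ge_self])
  then show ?thesis by blast
qed

lemma Linf_add: "f \<in> Linf M \<Longrightarrow> g \<in> Linf M \<Longrightarrow> (\<lambda>x. f x + g x) \<in> Linf M"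
  by (auto simp: Linf_def bounded_plus_comp)

lemma Linf_diff: "f \<in> Linf M \<Longrightarrow> g \<in> Linf M \<Longrightarrow> (\<lambda>x. f x - g x) \<in> Linf M"
  by (auto simp: Linf_def bounded_minus_comp)

lemma Linf_scaleR: "f \<in> Linf M \<Longrightarrow> (\<lambda>x. c *\<^sub>R f x) \<in> Linf M"
  using bounded_scaleR_comp[of f "space M" c] by (auto simp: Linf_def)

lemma Linf_indicator: "A \<in> sets M \<Longrightarrow> indicat_real A \<in> Linf M"
  by (rule LinfI[where C=1]) (auto simp: indicator_def dest: sets.sets_into_space)

lemma sup_norm_le:
  assumes "space M \<noteq> {}" "\<And>x. x \<in> space M \<Longrightarrow> norm (v x) \<le> c"
  shows "sup_norm M v \<le> c"
  unfolding sup_norm_def using assms by (intro cSUP_least)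

lemma norm_le_sup_norm:
  assumes "f \<in> Linf M" "x \<in> space M"
  shows "\<bar>f x\<bar> \<le> sup_norm M f"
proof -
  obtain C where "\<And>x. \<bar>f x\<bar> \<le> C" using Linf_bounded[OF assms(1)] by blast
  then have "bdd_above ((\<lambda>x. norm (f x)) ` space M)" by (auto intro!: bdd_aboveI)
  from cSUP_upper[OF assms(2) this] show ?thesis by (simp add: sup_norm_def)
qed

text \<open>Continuity proofs pass from \<open>f\<close> to the representative \<open>h\<close>,
  which has small supremum norm and the same lifting.\<close>

lemma quot_Linf_norm_less:
  assumes "f \<in> Linf M" "quot_Linf_norm M (ae_class M (Linf M) f) < d"
  obtains h where "h \<in> Linf M" "AE x in M. h x = f x" "sup_norm M h < d"
proof -
  have "sup_norm M ` ae_class M (Linf M) f \<noteq> {}"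
    using ae_class_self[OF assms(1)] by blast
  from cInf_lessD[OF this, of d] assms(2) show ?thesis
    by (auto simp: quot_Linf_norm_def ae_class_def intro: that)
qed

lemma quot_Linf_norm_le_sup_norm:
  assumes "f \<in> Linf M"
  shows "quot_Linf_norm M (ae_class M (Linf M) f) \<le> sup_norm M f"
  unfolding quot_Linf_norm_def
proof (rule cINF_lower[OF _ ae_class_self[OF assms]], rule bdd_belowI2)
  fix h assume "h \<in> ae_class M (Linf M) f"
  then have h: "h \<in> Linf M" by (simp add: ae_class_def)
  show "min 0 (Sup {}) \<le> sup_norm M h" \<comment> \<open>\<open>Sup {}\<close> is the value of \<open>sup_norm\<close> on an empty space\<close>
  proof (cases "space M = {}")
    case True then show ?thesis by (simp add: sup_norm_def)
  next
    case False
    then obtain x where "x \<in> space M" by blast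
    from norm_le_sup_norm[OF h this] show ?thesis by linarith
  qed
qed

lemma LinfBI:
  assumes "strongly_measurable M v" "\<And>x. x \<in> space M \<Longrightarrow> norm (v x) \<le> C"
    "\<And>x. x \<notin> space M \<Longrightarrow> v x = 0"
  shows "v \<in> LinfB M"
proof -
  have "v \<in> borel_measurable M" using assms(1) by (simp add: strongly_measurable_def)
  then have "(\<lambda>x. norm (v x)) \<in> Linf M"
    using assms by (intro LinfI[where C=C]) auto
  with assms(1) show ?thesis by (simp add: LinfB_def)
qed

lemma LinfB_strongly_measurable: "v \<in> LinfB M \<Longrightarrow> strongly_measurable M v"
  by (simp add: LinfB_def)

lemma LinfB_norm: "v \<in> LinfB M \<Longrightarrow> (\<lambda>x. norm (v x)) \<in> Linf M"
  by (simp add: LinfB_def)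

lemma LinfB_outside: "v \<in> LinfB M \<Longrightarrow> x \<notin> space M \<Longrightarrow> v x = 0"
  using Linf_outside[OF LinfB_norm] by fastforce

lemma LinfB_bounded:
  assumes "v \<in> LinfB M"
  shows "\<exists>C. \<forall>x. norm (v x) \<le> C"
  using Linf_bounded[OF LinfB_norm[OF assms]] by simp

lemma LinfB_blinfun_apply:
  assumes "v \<in> LinfB M"
  shows "(\<lambda>x. blinfun_apply \<phi> (v x)) \<in> Linf M"
proof -
  obtain C where C: "\<And>x. norm (v x) \<le> C" using LinfB_bounded[OF assms] by blast
  have [measurable]: "v \<in> borel_measurable M"
    using assms by (simp add: LinfB_def strongly_measurable_def)
  have [measurable]: "blinfun_apply \<phi> \<in> borel_measurable borel"
    by (intro borel_measurable_continuous_onI continuous_intros)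
  show ?thesis
  proof (rule LinfI[where C="norm \<phi> * C"])
    fix x
    have "norm (blinfun_apply \<phi> (v x)) \<le> norm \<phi> * norm (v x)" by (rule norm_blinfun)
    also have "\<dots> \<le> norm \<phi> * C" using C by (intro mult_left_mono) auto
    finally show "\<bar>blinfun_apply \<phi> (v x)\<bar> \<le> norm \<phi> * C" by simp
  qed (use assms in \<open>simp_all add: LinfB_outside\<close>)
qed

context complete_measure
begin

lemma LinfB_add:
  assumes "v \<in> LinfB M" "w \<in> LinfB M"
  shows "(\<lambda>x. v x + w x) \<in> LinfB M"
proof -
  obtain C where C: "\<And>x. norm (v x) \<le> C" using LinfB_bounded[OF assms(1)] by blast
  obtain D where D: "\<And>x. norm (w x) \<le> D" using LinfB_bounded[OF assms(2)] by blast
  show ?thesis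
  proof (rule LinfBI[where C="C + D"])
    show "strongly_measurable M (\<lambda>x. v x + w x)"
      using strongly_measurable_compose2[of v w "(+)", OF assms[THEN LinfB_strongly_measurable]]
      by (simp add: continuous_intros)
    show "norm (v x + w x) \<le> C + D" for x
      using norm_triangle_ineq[of "v x" "w x"] C[of x] D[of x] by linarith
  qed (use assms in \<open>simp_all add: LinfB_outside\<close>)
qed

lemma LinfB_fun_scaleR:
  assumes "f \<in> borel_measurable M" "\<And>x. \<bar>f x\<bar> \<le> D" "v \<in> LinfB M"
  shows "(\<lambda>x. f x *\<^sub>R v x) \<in> LinfB M"
proof -
  obtain C where C: "\<And>x. norm (v x) \<le> C" using LinfB_bounded[OF assms(3)] by blast
  show ?thesis
  proof (rule LinfBI[where C="D * C"])
    show "strongly_measurable M (\<lambda>x. f x *\<^sub>R v x)"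
      by (intro strongly_measurable_scaleR LinfB_strongly_measurable assms)
    show "norm (f x *\<^sub>R v x) \<le> D * C" for x
      using mult_mono[OF assms(2) C, of x x] order_trans[OF abs_ge_zero assms(2)] by simp
  qed (use assms in \<open>simp_all add: LinfB_outside\<close>)
qed

lemma LinfB_scaleR: "v \<in> LinfB M \<Longrightarrow> (\<lambda>x. c *\<^sub>R v x) \<in> LinfB M"
  by (rule LinfB_fun_scaleR[where D="\<bar>c\<bar>"]) auto

lemma LinfB_diff:
  assumes "v \<in> LinfB M" "w \<in> LinfB M"
  shows "(\<lambda>x. v x - w x) \<in> LinfB M"
  using LinfB_add[OF assms(1) LinfB_scaleR[OF assms(2), of "-1"]] by simp

end

subsection \<open>The ultrafilters of a lifting\<close>

locale measure_lifting = complete_measure M + sigma_finite_measure M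
  for M :: "'a measure" and l :: "'a set \<Rightarrow> 'a set" +
  assumes lifting: "von_neumann_lifting M l"
begin

lemma space_nonempty: "space M \<noteq> {}"
  using lifting[unfolded von_neumann_lifting_def, THEN conjunct1] by auto

lemmas lifting_conjs = lifting[unfolded von_neumann_lifting_def, THEN conjunct2]

lemma lift_sets: "E \<in> sets M \<Longrightarrow> l E \<in> sets M"
  by (rule funcset_mem[OF lifting_conjs[THEN conjunct1]])

lemma lift_empty: "l {} = {}"
  by (rule lifting_conjs[THEN conjunct2, THEN conjunct1])

lemma lift_space: "l (space M) = space M"
  by (rule lifting_conjs[THEN conjunct2, THEN conjunct2, THEN conjunct1])

lemmas lifting_conjs' = lifting_conjs[THEN conjunct2, THEN conjunct2, THEN conjunct2]

lemma lift_Int: "E \<in> sets M \<Longrightarrow> F \<in> sets M \<Longrightarrow> l (E \<inter> F) = l E \<inter> l F"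
  by (rule lifting_conjs'[THEN conjunct1, THEN bspec, THEN bspec, THEN conjunct1])

lemma lift_Un: "E \<in> sets M \<Longrightarrow> F \<in> sets M \<Longrightarrow> l (E \<union> F) = l E \<union> l F"
  by (rule lifting_conjs'[THEN conjunct1, THEN bspec, THEN bspec, THEN conjunct2])

lemma AE_iff_sym_diff:
  assumes "E \<in> sets M" "F \<in> sets M"
  shows "emeasure M (sym_diff E F) = 0 \<longleftrightarrow> (AE x in M. x \<in> E \<longleftrightarrow> x \<in> F)"
proof -
  have eq: "{x \<in> space M. \<not> (x \<in> E \<longleftrightarrow> x \<in> F)} = sym_diff E F"
    using assms[THEN sets.sets_into_space] by auto
  have "sym_diff E F \<in> sets M" using assms by auto
  then show ?thesis
    unfolding AE_iff_null_sets eq by (simp add: null_sets_def)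
qed

lemma lift_cong:
  assumes "E \<in> sets M" "F \<in> sets M" "AE x in M. x \<in> E \<longleftrightarrow> x \<in> F"
  shows "l E = l F"
  by (rule lifting_conjs'[THEN conjunct2, THEN conjunct1, THEN bspec, THEN bspec, THEN mp])
     (simp_all only: assms AE_iff_sym_diff)

lemma AE_lift_iff:
  assumes "E \<in> sets M"
  shows "AE x in M. x \<in> E \<longleftrightarrow> x \<in> l E"
  using lifting_conjs'[THEN conjunct2, THEN conjunct2, THEN bspec, OF assms]
  by (simp only: assms AE_iff_sym_diff lift_sets)

lemma emeasure_lift: "E \<in> sets M \<Longrightarrow> emeasure M (l E) = emeasure M E"
  using AE_lift_iff[of E] lift_sets[of E] by (intro emeasure_eq_AE) (simp_all add: eq_commute)

text \<open>A null set has the lifting of the empty set, which contains no point. Hence a set of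
  finite measure whose lifting contains \<open>x\<close> is always admissible for averages at
  \<open>x\<close>.\<close>

lemma emeasure_pos_if_lift:
  assumes "E \<in> sets M" "x \<in> l E"
  shows "0 < emeasure M E"
proof (rule ccontr)
  assume "\<not> 0 < emeasure M E"
  then have "E \<in> null_sets M" using assms(1) by (auto simp: null_sets_def)
  then have "l E = l {}"
    using assms(1) by (intro lift_cong) (auto dest: AE_not_in)
  with assms(2) show False by (simp add: lift_empty)
qed

text \<open>Encoded as a filter on points, so that limits are ordinary convergence statements. It
  decides measurable sets only and is in general not an ultrafilter on points.\<close>

definition lifting_filter :: "'a \<Rightarrow> 'a filter" where
  "lifting_filter x = (INF E\<in>{E \<in> sets M. x \<in> l E}. principal E)"

text \<open>Since \<open>l\<close> preserves intersections, the generating sets are directed, and a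
  single one of them witnesses an eventual property.\<close>

lemma eventually_lifting_filter:
  assumes "x \<in> space M"
  shows "eventually P (lifting_filter x) \<longleftrightarrow> (\<exists>E\<in>sets M. x \<in> l E \<and> (\<forall>y\<in>E. P y))"
proof -
  have "eventually P (lifting_filter x) \<longleftrightarrow> (\<exists>E\<in>{E \<in> sets M. x \<in> l E}. eventually P (principal E))"
    unfolding lifting_filter_def
  proof (rule eventually_INF_base)
    show "{E \<in> sets M. x \<in> l E} \<noteq> {}" using assms lift_space by blast
    show "\<exists>D\<in>{E \<in> sets M. x \<in> l E}. principal D \<le> inf (principal A) (principal B)"
      if "A \<in> {E \<in> sets M. x \<in> l E}" "B \<in> {E \<in> sets M. x \<in> l E}" for A B
      using that by (intro bexI[of _ "A \<inter> B"]) (auto simp: lift_Int)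
  qed
  then show ?thesis by (auto simp: eventually_principal)
qed

lemma lifting_filter_not_bot: "x \<in> space M \<Longrightarrow> lifting_filter x \<noteq> bot"
  by (auto simp: eventually_lifting_filter trivial_limit_def lift_empty)

lemma eventually_lifting_filterI:
  "E \<in> sets M \<Longrightarrow> x \<in> l E \<Longrightarrow> (\<And>y. y \<in> E \<Longrightarrow> P y) \<Longrightarrow> eventually P (lifting_filter x)"
  using sets.sets_into_space[OF lift_sets] by (subst eventually_lifting_filter) auto

lemma eventually_lifting_filter_space: "x \<in> space M \<Longrightarrow> eventually (\<lambda>y. y \<in> space M) (lifting_filter x)"
  by (rule eventually_lifting_filterI[of "space M"]) (auto simp: lift_space)

text \<open>A conull set has the same lifting as the whole space, so it belongs to the filter at
  every point. Limits therefore depend only on the a.e. class, with no exceptional points; this is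
  why (b), (c) and (d) hold everywhere.\<close>

lemma eventually_lifting_filter_AE:
  assumes "AE y in M. P y" "x \<in> space M"
  shows "eventually P (lifting_filter x)"
proof (rule eventually_lifting_filterI)
  \<comment> \<open>\<open>P\<close> is arbitrary; completeness makes the exceptional set
    measurable.\<close>
  have "{y \<in> space M. \<not> P y} \<in> null_sets M"
    using assms(1) by (simp add: AE_iff_null_sets)
  then have "space M - {y \<in> space M. \<not> P y} \<in> sets M" by auto
  moreover have "space M - {y \<in> space M. \<not> P y} = {y \<in> space M. P y}" by auto
  ultimately show S: "{y \<in> space M. P y} \<in> sets M" by simp
  have "l {y \<in> space M. P y} = l (space M)"
  proof (rule lift_cong[OF S sets.top])
    show "AE y in M. y \<in> {y \<in> space M. P y} \<longleftrightarrow> y \<in> space M"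
      using assms(1) by eventually_elim simp
  qed
  with assms(2) show "x \<in> l {y \<in> space M. P y}" by (simp add: lift_space)
qed simp

text \<open>The ultrafilter dichotomy: the liftings of \<open>E\<close> and of its complement cover
  the space.\<close>

lemma eventually_lifting_filter_cases:
  assumes "E \<in> sets M" "x \<in> space M"
  obtains "x \<in> l E" "eventually (\<lambda>y. y \<in> E) (lifting_filter x)"
  | "x \<notin> l E" "eventually (\<lambda>y. y \<notin> E) (lifting_filter x)"
proof (cases "x \<in> l E")
  case True
  then show ?thesis using assms by (intro that(1) eventually_lifting_filterI[of E]) auto
next
  case False
  have "l E \<union> l (space M - E) = space M"
    using assms(1) sets.sets_into_space[OF assms(1)]
    by (subst lift_Un[symmetric]) (auto simp: lift_space Un_absorb1)
  with False assms show ?thesis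
    by (intro that(2) eventually_lifting_filterI[of "space M - E"]) auto
qed

text \<open>
  Convergence at almost every point replaces Lebesgue differentiation: it only needs the sets
  \<open>{x. dist (v x) d < 1 / n}\<close> for countably many \<open>d\<close> to agree with their liftings.
\<close>

lemma AE_tendsto_lifting_filter:
  fixes v :: "'a \<Rightarrow> 'b::real_normed_vector"
  assumes v: "strongly_measurable M v"
  shows "AE x in M. (v \<longlongrightarrow> v x) (lifting_filter x)"
proof -
  obtain D where D: "countable D" "AE x in M. v x \<in> closure D"
    using v by (rule strongly_measurable_separable)
  have [measurable]: "v \<in> borel_measurable M" using v by (simp add: strongly_measurable_def)
  define A where "A d n = {x \<in> space M. dist (v x) d < 1 / real (Suc n)}" for d n
  have A: "A d n \<in> sets M" for d n
  proof -
    have "(\<lambda>y. dist y d) \<in> borel_measurable borel"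
      by (intro borel_measurable_continuous_onI continuous_intros)
    then have [measurable]: "(\<lambda>x. dist (v x) d) \<in> borel_measurable M" by measurable
    show ?thesis unfolding A_def by measurable
  qed
  have "AE x in M. \<forall>d\<in>D. \<forall>n. x \<in> A d n \<longleftrightarrow> x \<in> l (A d n)"
    using D(1) A by (simp add: AE_ball_countable AE_all_countable AE_lift_iff)
  with D(2) AE_space show ?thesis
  proof eventually_elim
    case (elim x)
    show ?case
    proof (rule tendstoI)
      fix e :: real assume "e > 0"
      \<comment> \<open>Half of \<open>e\<close>, since \<open>v x\<close> and \<open>v y\<close>
        will both be within \<open>1 / real (Suc n)\<close> of the same \<open>d\<close>.\<close>
      then obtain n where n: "1 / real (Suc n) < e / 2"
        using nat_approx_posE[of "e / 2"] by auto
      have "0 < 1 / real (Suc n)" by simp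
      with elim(1) obtain d where d: "d \<in> D" "dist d (v x) < 1 / real (Suc n)"
        unfolding closure_approachable by blast
      with elim have "x \<in> l (A d n)" by (auto simp: A_def dist_commute)
      then show "eventually (\<lambda>y. dist (v y) (v x) < e) (lifting_filter x)"
      proof (rule eventually_lifting_filterI[OF A])
        fix y assume "y \<in> A d n"
        with d n dist_triangle[of "v y" "v x" d] show "dist (v y) (v x) < e"
          by (simp add: A_def)
      qed
    qed
  qed
qed

subsection \<open>Lifting of functions\<close>

text \<open>Compactness of a bounded interval gives a cluster point \<open>c\<close> of the image
  filter. The dichotomy applied to \<open>{y. dist (f y) c < e}\<close> makes it a limit: if the
  complement were in the filter, \<open>c\<close> would not be a cluster point.\<close>

lemma Linf_convergent:
  assumes f: "f \<in> Linf M" and x: "x \<in> space M"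
  shows "\<exists>c. (f \<longlongrightarrow> c) (lifting_filter x)"
proof -
  have [measurable]: "f \<in> borel_measurable M" using f by (rule Linf_measurable)
  obtain C where C: "\<And>x. \<bar>f x\<bar> \<le> C" using Linf_bounded[OF f] by blast
  let ?F = "filtermap f (lifting_filter x)"
  have "?F \<noteq> bot" using lifting_filter_not_bot[OF x] by (simp add: filtermap_bot_iff)
  moreover have "eventually (\<lambda>y. y \<in> {-C..C}) ?F"
    using C by (simp add: eventually_filtermap abs_le_iff minus_le_iff)
  ultimately obtain c where c: "inf (nhds c) ?F \<noteq> bot"
    using compact_Icc[of "-C" C, unfolded compact_filter] by blast
  have "(f \<longlongrightarrow> c) (lifting_filter x)"
  proof (rule tendstoI)
    fix e :: real assume "e > 0"
    define A where "A = {y \<in> space M. dist (f y) c < e}"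
    have "A \<in> sets M" unfolding A_def by measurable
    then show "eventually (\<lambda>y. dist (f y) c < e) (lifting_filter x)"
      using x
    proof (cases rule: eventually_lifting_filter_cases)
      case 1
      from this(2) show ?thesis by eventually_elim (simp add: A_def)
    next
      case 2
      have "eventually (\<lambda>y. \<not> dist (f y) c < e) (lifting_filter x)"
        using 2(2) eventually_lifting_filter_space[OF x] by eventually_elim (simp add: A_def)
      then have "eventually (\<lambda>y. \<not> dist y c < e) ?F" by (simp add: eventually_filtermap)
      moreover have "eventually (\<lambda>y. dist y c < e) (nhds c)"
        using \<open>e > 0\<close> by (auto simp: eventually_nhds_metric)
      ultimately have "eventually (\<lambda>_. False) (inf (nhds c) ?F)"
        by (auto simp: eventually_inf)
      with c show ?thesis by (simp add: trivial_limit_def)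
    qed
  qed
  then show ?thesis ..
qed

definition lift_fun :: "('a \<Rightarrow> real) \<Rightarrow> 'a \<Rightarrow> real" where
  "lift_fun f x = (if x \<in> space M then Lim (lifting_filter x) f else 0)"

lemma lift_fun_eqI: "x \<in> space M \<Longrightarrow> (f \<longlongrightarrow> c) (lifting_filter x) \<Longrightarrow> lift_fun f x = c"
  by (simp add: lift_fun_def tendsto_Lim lifting_filter_not_bot)

lemma tendsto_lift_fun:
  assumes "f \<in> Linf M" "x \<in> space M"
  shows "(f \<longlongrightarrow> lift_fun f x) (lifting_filter x)"
  using Linf_convergent[OF assms] lift_fun_eqI[OF assms(2)] by metis

lemma lift_fun_cong:
  assumes "f \<in> Linf M" "AE x in M. f x = g x"
  shows "lift_fun f = lift_fun g"
proof
  fix x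
  show "lift_fun f x = lift_fun g x"
  proof (cases "x \<in> space M")
    case True
    have "(g \<longlongrightarrow> lift_fun f x) (lifting_filter x)"
      using tendsto_lift_fun[OF assms(1) True] eventually_lifting_filter_AE[OF assms(2) True]
      by (rule Lim_transform_eventually)
    from lift_fun_eqI[OF True this] show ?thesis by simp
  qed (simp add: lift_fun_def)
qed

lemma AE_lift_fun:
  assumes "f \<in> Linf M"
  shows "AE x in M. lift_fun f x = f x"
proof -
  \<comment> \<open>Writing \<open>f\<close> as a multiple of the constant 1 gives strong
    measurability even when its support has infinite measure; sigma-finiteness enters through the
    constant.\<close>
  have "strongly_measurable M (\<lambda>x. f x *\<^sub>R (1::real))"
    by (intro strongly_measurable_scaleR strongly_measurable_const Linf_measurable assms)
       unfold_locales
  from AE_tendsto_lifting_filter[OF this] AE_space show ?thesis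
    by eventually_elim (simp add: lift_fun_eqI)
qed

lemma abs_lift_fun_le:
  assumes "f \<in> Linf M" "x \<in> space M" "\<And>y. y \<in> space M \<Longrightarrow> \<bar>f y\<bar> \<le> C"
  shows "\<bar>lift_fun f x\<bar> \<le> C"
proof (rule tendsto_upperbound)
  show "((\<lambda>y. \<bar>f y\<bar>) \<longlongrightarrow> \<bar>lift_fun f x\<bar>) (lifting_filter x)"
    by (intro tendsto_rabs tendsto_lift_fun assms)
  show "eventually (\<lambda>y. \<bar>f y\<bar> \<le> C) (lifting_filter x)"
    using eventually_lifting_filter_space[OF assms(2)] by eventually_elim (rule assms)
qed (simp add: lifting_filter_not_bot assms)

text \<open>A limit along an uncountably generated filter carries no measurability by itself; it
  comes from a.e. equality with \<open>f\<close>.\<close>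

lemma lift_fun_Linf:
  assumes "f \<in> Linf M"
  shows "lift_fun f \<in> Linf M"
proof -
  obtain C where C: "\<And>x. \<bar>f x\<bar> \<le> C" using Linf_bounded[OF assms] by blast
  have "lift_fun f \<in> borel_measurable M"
    using Linf_measurable[OF assms] AE_lift_fun[OF assms] by (rule borel_measurable_AE_cong)
  with C show ?thesis
    by (intro LinfI[where C=C] abs_lift_fun_le assms) (auto simp: lift_fun_def)
qed

lemma lift_fun_indicator:
  assumes "E \<in> sets M"
  shows "lift_fun (indicat_real E) = indicat_real (l E)"
proof
  fix x
  show "lift_fun (indicat_real E) x = indicat_real (l E) x"
  proof (cases "x \<in> space M")
    case True
    from assms True show ?thesis
    proof (cases rule: eventually_lifting_filter_cases)
      case 1
      have "eventually (\<lambda>y. 1 = indicat_real E y) (lifting_filter x)"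
        using 1(2) by eventually_elim simp
      from lift_fun_eqI[OF True Lim_transform_eventually[OF tendsto_const this]] 1 show ?thesis
        by simp
    next
      case 2
      have "eventually (\<lambda>y. 0 = indicat_real E y) (lifting_filter x)"
        using 2(2) by eventually_elim simp
      from lift_fun_eqI[OF True Lim_transform_eventually[OF tendsto_const this]] 2 show ?thesis
        by simp
    qed
  next
    case False
    then show ?thesis
      using sets.sets_into_space[OF lift_sets[OF assms]] by (auto simp: lift_fun_def indicator_def)
  qed
qed

end

section \<open>Uniform approximation by simple functions, and the canonical embedding\<close>

lemma Linf_sum_indicator:
  assumes "finite K" "\<And>k. k \<in> K \<Longrightarrow> A k \<in> sets M"
  shows "(\<lambda>x. \<Sum>k\<in>K. c k *\<^sub>R indicat_real (A k) x) \<in> Linf M"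
  using assms
proof (induction K rule: finite_induct)
  case empty
  show ?case by (rule LinfI[where C=0]) auto
next
  case (insert k K)
  then have "(\<lambda>x. c k *\<^sub>R indicat_real (A k) x + (\<Sum>k\<in>K. c k *\<^sub>R indicat_real (A k) x)) \<in> Linf M"
    by (intro Linf_add Linf_scaleR Linf_indicator) auto
  then show ?case by (simp only: sum.insert[OF insert.hyps])
qed

text \<open>Rounds \<open>f\<close> down to the nearest multiple of \<open>d\<close>; boundedness
  leaves only finitely many multiples.\<close>

lemma Linf_approx_simple:
  fixes f :: "'a \<Rightarrow> real"
  assumes f: "f \<in> Linf M" and "d > 0"
  obtains K :: "int set" and A c where "finite K" "\<And>k. A k \<in> sets M"
    "\<And>x. x \<in> space M \<Longrightarrow> \<bar>(\<Sum>k\<in>K. c k *\<^sub>R indicat_real (A k) x) - f x\<bar> \<le> d"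
proof -
  have [measurable]: "f \<in> borel_measurable M" using f by (rule Linf_measurable)
  obtain C where C: "\<And>x. \<bar>f x\<bar> \<le> C" using Linf_bounded[OF f] by blast
  define K where "K = {\<lfloor>- C / d\<rfloor>..\<lfloor>C / d\<rfloor>}"
  define A where "A k = {x \<in> space M. \<lfloor>f x / d\<rfloor> = k}" for k
  have "\<bar>(\<Sum>k\<in>K. (d * of_int k) *\<^sub>R indicat_real (A k) x) - f x\<bar> \<le> d" if "x \<in> space M" for x
  proof -
    have "- C / d \<le> f x / d" "f x / d \<le> C / d"
      using C[of x] \<open>d > 0\<close> by (intro divide_right_mono; simp add: abs_le_iff)+
    then have "\<lfloor>f x / d\<rfloor> \<in> K"
      by (auto simp: K_def intro: floor_mono)
    moreover have "(\<Sum>k\<in>K. (d * of_int k) *\<^sub>R indicat_real (A k) x) =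
        (\<Sum>k\<in>K. if k = \<lfloor>f x / d\<rfloor> then d * of_int k else 0)"
      using that by (intro sum.cong) (auto simp: A_def)
    ultimately have "(\<Sum>k\<in>K. (d * of_int k) *\<^sub>R indicat_real (A k) x) = d * of_int \<lfloor>f x / d\<rfloor>"
      by (simp add: K_def)
    moreover have "d * of_int \<lfloor>f x / d\<rfloor> \<le> d * (f x / d)" "d * (f x / d) \<le> d * (of_int \<lfloor>f x / d\<rfloor> + 1)"
      using \<open>d > 0\<close> by (intro mult_left_mono; linarith)+
    ultimately show ?thesis
      using \<open>d > 0\<close> by (simp add: abs_le_iff distrib_left)
  qed
  moreover have "finite K" by (simp add: K_def)
  moreover have "A k \<in> sets M" for k unfolding A_def by measurable
  ultimately show ?thesis by (rule that[rotated 2])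
qed

text \<open>Continuity of the embedding carries strong measurability from \<open>v\<close> to its
  image in the bidual.\<close>

lemma bounded_linear_canonical_embedding:
  "bounded_linear (canonical_embedding :: 'b::real_normed_vector \<Rightarrow> _)"
proof (rule bounded_linear_intro[where K=1])
  show "canonical_embedding (x + y) = canonical_embedding x + canonical_embedding y" for x y :: 'b
    by (rule blinfun_eqI) (simp add: canonical_embedding_apply blinfun.add_left blinfun.add_right)
  show "canonical_embedding (r *\<^sub>R x) = r *\<^sub>R canonical_embedding x" for r and x :: 'b
    by (rule blinfun_eqI) (simp add: canonical_embedding_apply blinfun.scaleR_left blinfun.scaleR_right)
  show "norm (canonical_embedding x) \<le> norm x * 1" for x :: 'b
  proof (rule norm_blinfun_bound)
    show "norm (blinfun_apply (canonical_embedding x) \<phi>) \<le> norm x * 1 * norm \<phi>" for \<phi>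
      using norm_blinfun[of \<phi> x] by (simp add: canonical_embedding_apply mult.commute)
  qed simp
qed

section \<open>The induced map on classes of functions: uniqueness and existence\<close>

context measure_lifting
begin

lemma lift_fun_add:
  assumes "f \<in> Linf M" "g \<in> Linf M"
  shows "lift_fun (\<lambda>y. f y + g y) x = lift_fun f x + lift_fun g x"
proof (cases "x \<in> space M")
  case True
  with assms show ?thesis by (intro lift_fun_eqI tendsto_add tendsto_lift_fun)
qed (simp add: lift_fun_def)

lemma lift_fun_diff:
  assumes "f \<in> Linf M" "g \<in> Linf M"
  shows "lift_fun (\<lambda>y. f y - g y) x = lift_fun f x - lift_fun g x"
proof (cases "x \<in> space M")
  case True
  with assms show ?thesis by (intro lift_fun_eqI tendsto_diff tendsto_lift_fun)
qed (simp add: lift_fun_def)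

lemma lift_fun_scaleR:
  assumes "f \<in> Linf M"
  shows "lift_fun (\<lambda>y. c *\<^sub>R f y) x = c *\<^sub>R lift_fun f x"
proof (cases "x \<in> space M")
  case True
  with assms show ?thesis by (intro lift_fun_eqI tendsto_scaleR tendsto_const tendsto_lift_fun)
qed (simp add: lift_fun_def)

lemma abs_lift_fun_le_sup_norm:
  assumes "f \<in> Linf M" "x \<in> space M"
  shows "\<bar>lift_fun f x\<bar> \<le> sup_norm M f"
  by (rule abs_lift_fun_le[OF assms norm_le_sup_norm[OF assms(1)]])

text \<open>The property inside the definite description of \<open>fun_lifting\<close>, named so
  that existence and uniqueness can be stated.\<close>

definition induces_lifting :: "(('a \<Rightarrow> real) set \<Rightarrow> 'a \<Rightarrow> real) \<Rightarrow> bool" where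
  "induces_lifting L \<longleftrightarrow>
     L \<in> quot_Linf M \<rightarrow>\<^sub>E Linf M \<and>
     linear_on_classes M (Linf M) (quot_Linf M) L \<and>
     continuous_on_classes M (Linf M) (quot_Linf M) (quot_Linf_norm M) L \<and>
     (\<forall>E\<in>sets M. L (ae_class M (Linf M) (indicat_real E)) = indicat_real (l E))"

lemma induces_lifting_simple:
  assumes L: "induces_lifting L" and x: "x \<in> space M"
    and K: "finite K" "\<And>k. k \<in> K \<Longrightarrow> A k \<in> sets M"
  shows "L (ae_class M (Linf M) (\<lambda>x. \<Sum>k\<in>K. c k *\<^sub>R indicat_real (A k) x)) x =
    (\<Sum>k\<in>K. c k *\<^sub>R indicat_real (l (A k)) x)"
proof -
  let ?cl = "ae_class M (Linf M)"
  have lin: "linear_on_classes M (Linf M) (quot_Linf M) L"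
    and ind: "\<And>E. E \<in> sets M \<Longrightarrow> L (?cl (indicat_real E)) = indicat_real (l E)"
    using L by (simp_all add: induces_lifting_def)
  have scale: "L (?cl (\<lambda>x. c *\<^sub>R f x)) x = c *\<^sub>R L (?cl f) x" if "f \<in> Linf M" for f c
  proof -
    have "?cl f \<in> quot_Linf M" using that by (simp add: quot_Linf_def)
    from lin[unfolded linear_on_classes_def, THEN conjunct2, THEN spec, THEN bspec, OF this, THEN bspec, OF x]
    show ?thesis by (simp only: lift1_ae_class[OF that])
  qed
  have add: "L (?cl (\<lambda>x. f x + g x)) x = L (?cl f) x + L (?cl g) x" if "f \<in> Linf M" "g \<in> Linf M" for f g
  proof -
    have F: "?cl f \<in> quot_Linf M" and G: "?cl g \<in> quot_Linf M"
      using that by (simp_all add: quot_Linf_def)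
    from lin[unfolded linear_on_classes_def, THEN conjunct1, THEN bspec, OF F, THEN bspec, OF G, THEN bspec, OF x]
    show ?thesis by (simp only: lift2_ae_class[OF that])
  qed
  show ?thesis using K
  proof (induction K rule: finite_induct)
    case empty
    \<comment> \<open>The empty sum is 0 times the indicator of the empty set, so homogeneity gives
      the value 0.\<close>
    show ?case using scale[OF Linf_indicator[OF sets.empty_sets], of 0] by simp
  next
    case (insert k K)
    then have A: "A k \<in> sets M" "\<And>k. k \<in> K \<Longrightarrow> A k \<in> sets M" by auto
    show ?case
      by (simp only: sum.insert[OF insert.hyps] insert.IH[OF A(2)] ind[OF A(1)]
          scale[OF Linf_indicator[OF A(1)]] add[OF Linf_scaleR[OF Linf_indicator[OF A(1)]]
          Linf_sum_indicator[where K=K and A=A, OF insert.hyps(1) A(2)]])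
  qed
qed

text \<open>Two such maps agree on simple functions, which are uniformly dense, and both are
  continuous. Extensionality and vanishing outside \<open>space M\<close> settle the remaining
  arguments.\<close>

lemma induces_lifting_unique:
  assumes L: "induces_lifting L" and L': "induces_lifting L'"
  shows "L = L'"
proof (rule PiE_ext)
  let ?cl = "ae_class M (Linf M)"
  show PL: "L \<in> quot_Linf M \<rightarrow>\<^sub>E Linf M" and PL': "L' \<in> quot_Linf M \<rightarrow>\<^sub>E Linf M"
    using L L' by (simp_all add: induces_lifting_def)
  fix F assume F: "F \<in> quot_Linf M"
  then obtain f where f: "f \<in> Linf M" "F = ?cl f" by (auto simp: quot_Linf_def)
  have cont: "continuous_on_classes M (Linf M) (quot_Linf M) (quot_Linf_norm M) T" if "induces_lifting T" for T
    using that by (simp add: induces_lifting_def)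
  have Linf: "L G \<in> Linf M" "L' G \<in> Linf M" if "G \<in> quot_Linf M" for G
    using PL PL' that by (auto simp: PiE_iff)
  show "L F = L' F"
  proof
    fix x
    show "L F x = L' F x"
    proof (cases "x \<in> space M")
      case False
      then show ?thesis using Linf[OF F] by (simp add: Linf_outside)
    next
      case True
      have "dist (L F x) (L' F x) \<le> e" if "e > 0" for e
      proof -
        obtain d1 where d1: "d1 > 0" "\<And>W. W \<in> quot_Linf M \<Longrightarrow>
            quot_Linf_norm M (lift2 M (Linf M) (-) W F) < d1 \<Longrightarrow> sup_norm M (\<lambda>x. L W x - L F x) < e / 2"
          using cont[OF L, unfolded continuous_on_classes_def, THEN bspec, OF F] \<open>e > 0\<close>
          by (meson half_gt_zero)
        obtain d2 where d2: "d2 > 0" "\<And>W. W \<in> quot_Linf M \<Longrightarrow>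
            quot_Linf_norm M (lift2 M (Linf M) (-) W F) < d2 \<Longrightarrow> sup_norm M (\<lambda>x. L' W x - L' F x) < e / 2"
          using cont[OF L', unfolded continuous_on_classes_def, THEN bspec, OF F] \<open>e > 0\<close>
          by (meson half_gt_zero)
        \<comment> \<open>Halved because the approximation only gives a distance of at most
          \<open>d\<close>, while continuity asks for strict inequalities.\<close>
        define d where "d = min d1 d2 / 2"
        have d: "d > 0" "d < d1" "d < d2" using d1(1) d2(1) by (auto simp: d_def)
        obtain K :: "int set" and A c where K: "finite K" "\<And>k. A k \<in> sets M"
          "\<And>x. x \<in> space M \<Longrightarrow> \<bar>(\<Sum>k\<in>K. c k *\<^sub>R indicat_real (A k) x) - f x\<bar> \<le> d"
          using f(1) d(1) by (rule Linf_approx_simple) blast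
        let ?g = "\<lambda>x. \<Sum>k\<in>K. c k *\<^sub>R indicat_real (A k) x"
        have g: "?g \<in> Linf M" using K by (intro Linf_sum_indicator)
        then have G: "?cl ?g \<in> quot_Linf M" by (simp add: quot_Linf_def)
        have "quot_Linf_norm M (lift2 M (Linf M) (-) (?cl ?g) F) \<le> sup_norm M (\<lambda>x. ?g x - f x)"
          unfolding f(2) lift2_ae_class[OF g f(1)]
          by (rule quot_Linf_norm_le_sup_norm[OF Linf_diff[OF g f(1)]])
        also have "\<dots> \<le> d"
          using K(3) by (intro sup_norm_le space_nonempty) simp
        finally have "sup_norm M (\<lambda>x. L (?cl ?g) x - L F x) < e / 2"
            "sup_norm M (\<lambda>x. L' (?cl ?g) x - L' F x) < e / 2"
          using d d1(2)[OF G] d2(2)[OF G] by auto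
        then have "\<bar>L (?cl ?g) x - L F x\<bar> < e / 2" "\<bar>L' (?cl ?g) x - L' F x\<bar> < e / 2"
          using norm_le_sup_norm[OF Linf_diff[OF Linf(1)[OF G] Linf(1)[OF F]] True]
            norm_le_sup_norm[OF Linf_diff[OF Linf(2)[OF G] Linf(2)[OF F]] True] by linarith+
        moreover have "L (?cl ?g) x = L' (?cl ?g) x"
          using induces_lifting_simple[OF L True K(1,2)] induces_lifting_simple[OF L' True K(1,2)] by simp
        ultimately show ?thesis unfolding dist_real_def by linarith
      qed
      then have "dist (L F x) (L' F x) \<le> 0" by (rule field_le_epsilon) simp
      then show ?thesis by simp
    qed
  qed
qed

text \<open>The choice of a representative is immaterial by \<open>lift_fun_cong\<close>; the
  restriction to \<open>quot_Linf M\<close> provides the extensionality required by the definite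
  description.\<close>

lemma lift_fun_induces:
  defines "L \<equiv> (\<lambda>F\<in>quot_Linf M. lift_fun (SOME f. f \<in> F))"
  shows "induces_lifting L" "\<And>f. f \<in> Linf M \<Longrightarrow> L (ae_class M (Linf M) f) = lift_fun f"
proof -
  let ?cl = "ae_class M (Linf M)"
  show L: "L (?cl f) = lift_fun f" if "f \<in> Linf M" for f
  proof -
    have "(SOME g. g \<in> ?cl f) \<in> ?cl f"
      using ae_class_self[OF that] by (rule someI[of "\<lambda>g. g \<in> ?cl f"])
    then have "lift_fun (SOME g. g \<in> ?cl f) = lift_fun f"
      by (intro lift_fun_cong) (auto simp: ae_class_def)
    with that show ?thesis by (simp add: L_def quot_Linf_def)
  qed
  have "L \<in> quot_Linf M \<rightarrow>\<^sub>E Linf M"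
  proof (rule PiE_I)
    show "L F \<in> Linf M" if "F \<in> quot_Linf M" for F
      using that L by (auto simp: quot_Linf_def lift_fun_Linf)
  qed (simp add: L_def)
  moreover have "linear_on_classes M (Linf M) (quot_Linf M) L"
    unfolding linear_on_classes_def quot_Linf_def
    by (auto simp: L lift1_ae_class lift2_ae_class Linf_add Linf_scaleR[simplified] lift_fun_add
        lift_fun_scaleR[simplified])
  moreover have "continuous_on_classes M (Linf M) (quot_Linf M) (quot_Linf_norm M) L"
    unfolding continuous_on_classes_def
  proof (intro ballI allI impI)
    fix V and e :: real assume "V \<in> quot_Linf M" "e > 0"
    then obtain v where v: "v \<in> Linf M" "V = ?cl v" by (auto simp: quot_Linf_def)
    have "sup_norm M (\<lambda>x. L W x - L V x) < e"
      if W: "W \<in> quot_Linf M" and small: "quot_Linf_norm M (lift2 M (Linf M) (-) W V) < e / 2" for W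
    proof -
      obtain w where w: "w \<in> Linf M" "W = ?cl w" using W by (auto simp: quot_Linf_def)
      have wv: "(\<lambda>x. w x - v x) \<in> Linf M" by (intro Linf_diff v w)
      obtain h where h: "h \<in> Linf M" "AE x in M. h x = w x - v x" "sup_norm M h < e / 2"
        using small unfolding v(2) w(2) lift2_ae_class[OF w(1) v(1)] by (rule quot_Linf_norm_less[OF wv])
      have "sup_norm M (\<lambda>x. L W x - L V x) \<le> sup_norm M h"
      proof (intro sup_norm_le space_nonempty)
        fix x assume "x \<in> space M"
        with abs_lift_fun_le_sup_norm[OF h(1)] show "norm (L W x - L V x) \<le> sup_norm M h"
          by (simp add: v w L lift_fun_cong[OF h(1,2)] lift_fun_diff)
      qed
      with h(3) \<open>e > 0\<close> show ?thesis by linarith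
    qed
    with \<open>e > 0\<close> show "\<exists>d>0. \<forall>W\<in>quot_Linf M.
        quot_Linf_norm M (lift2 M (Linf M) (-) W V) < d \<longrightarrow> sup_norm M (\<lambda>x. L W x - L V x) < e"
      by (intro exI[of _ "e / 2"]) auto
  qed
  moreover have "\<forall>E\<in>sets M. L (?cl (indicat_real E)) = indicat_real (l E)"
    by (simp add: L Linf_indicator lift_fun_indicator)
  ultimately show "induces_lifting L" by (simp add: induces_lifting_def)
qed

lemma fun_lifting_ae_class:
  assumes "f \<in> Linf M"
  shows "fun_lifting M l (ae_class M (Linf M) f) = lift_fun f"
proof -
  have "fun_lifting M l = (THE L. induces_lifting L)"
    by (simp add: fun_lifting_def induces_lifting_def)
  also have "\<dots> = (\<lambda>F\<in>quot_Linf M. lift_fun (SOME f. f \<in> F))"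
    using lift_fun_induces(1) induces_lifting_unique by (intro the_equality) auto
  finally show ?thesis using lift_fun_induces(2)[OF assms] by simp
qed

subsection \<open>Lifting of sections\<close>

text \<open>\<open>Blinfun\<close> is meaningful only on bounded linear maps;
  \<open>bidual_lift_apply\<close> checks this for \<open>v\<close> in
  \<open>LinfB M\<close>.\<close>

definition bidual_lift ::
  "('a \<Rightarrow> 'b::real_normed_vector) \<Rightarrow> 'a \<Rightarrow> (('b \<Rightarrow>\<^sub>L real) \<Rightarrow>\<^sub>L real)" where
  "bidual_lift v x = Blinfun (\<lambda>\<phi>. lift_fun (\<lambda>y. blinfun_apply \<phi> (v y)) x)"

text \<open>The pointwise operator bound passes to the limit. It yields boundedness in the
  functional and, since the factor of \<open>norm \<phi>\<close> is the lifted norm, also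
  (d).\<close>

lemma abs_lift_fun_blinfun_le:
  assumes v: "v \<in> LinfB M"
  shows "\<bar>lift_fun (\<lambda>y. blinfun_apply \<phi> (v y)) x\<bar> \<le> lift_fun (\<lambda>y. norm (v y)) x * norm \<phi>"
proof (cases "x \<in> space M")
  case x: True
  show ?thesis
  proof (rule tendsto_le)
    show "((\<lambda>y. \<bar>blinfun_apply \<phi> (v y)\<bar>) \<longlongrightarrow> \<bar>lift_fun (\<lambda>y. blinfun_apply \<phi> (v y)) x\<bar>) (lifting_filter x)"
      by (intro tendsto_rabs tendsto_lift_fun LinfB_blinfun_apply v x)
    show "((\<lambda>y. norm (v y) * norm \<phi>) \<longlongrightarrow> lift_fun (\<lambda>y. norm (v y)) x * norm \<phi>) (lifting_filter x)"
      by (intro tendsto_mult tendsto_const tendsto_lift_fun LinfB_norm v x)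
    have "\<bar>blinfun_apply \<phi> (v y)\<bar> \<le> norm (v y) * norm \<phi>" for y
      using norm_blinfun[of \<phi> "v y"] by (simp add: mult.commute)
    then show "\<forall>\<^sub>F y in lifting_filter x. \<bar>blinfun_apply \<phi> (v y)\<bar> \<le> norm (v y) * norm \<phi>"
      by (intro always_eventually allI)
  qed (rule lifting_filter_not_bot[OF x])
qed (simp add: lift_fun_def)

lemma lift_fun_norm_nonneg:
  assumes v: "v \<in> LinfB M"
  shows "0 \<le> lift_fun (\<lambda>y. norm (v y)) x"
proof (cases "x \<in> space M")
  case True
  show ?thesis
    by (rule tendsto_lowerbound[OF tendsto_lift_fun[OF LinfB_norm[OF v] True]])
       (simp_all add: lifting_filter_not_bot True)
qed (simp add: lift_fun_def)

lemma bidual_lift_apply: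
  assumes v: "v \<in> LinfB M"
  shows "blinfun_apply (bidual_lift v x) \<phi> = lift_fun (\<lambda>y. blinfun_apply \<phi> (v y)) x"
proof -
  have "bounded_linear (\<lambda>\<phi>. lift_fun (\<lambda>y. blinfun_apply \<phi> (v y)) x)"
  proof (rule bounded_linear_intro)
    show "norm (lift_fun (\<lambda>y. blinfun_apply \<phi> (v y)) x) \<le> norm \<phi> * lift_fun (\<lambda>y. norm (v y)) x" for \<phi>
      using abs_lift_fun_blinfun_le[OF v] by (simp add: mult.commute)
  qed (simp_all add: blinfun.add_left blinfun.scaleR_left lift_fun_add LinfB_blinfun_apply[OF v]
      lift_fun_scaleR[simplified])
  then show ?thesis by (simp add: bidual_lift_def bounded_linear_Blinfun_apply)
qed

lemma norm_bidual_lift_le: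
  assumes "v \<in> LinfB M"
  shows "norm (bidual_lift v x) \<le> lift_fun (\<lambda>y. norm (v y)) x"
  using abs_lift_fun_blinfun_le[OF assms] lift_fun_norm_nonneg[OF assms]
  by (intro norm_blinfun_bound) (auto simp: bidual_lift_apply[OF assms])

lemma bidual_lift_cong:
  assumes "v \<in> LinfB M" "AE x in M. v x = w x"
  shows "bidual_lift v = bidual_lift w"
proof -
  have "lift_fun (\<lambda>y. blinfun_apply \<phi> (v y)) = lift_fun (\<lambda>y. blinfun_apply \<phi> (w y))" for \<phi>
  proof (rule lift_fun_cong[OF LinfB_blinfun_apply[OF assms(1)]])
    show "AE x in M. blinfun_apply \<phi> (v x) = blinfun_apply \<phi> (w x)"
      using assms(2) by eventually_elim simp
  qed
  then show ?thesis by (simp add: bidual_lift_def fun_eq_iff)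
qed

lemma bidual_lift_add:
  assumes "v \<in> LinfB M" "w \<in> LinfB M"
  shows "bidual_lift (\<lambda>y. v y + w y) x = bidual_lift v x + bidual_lift w x"
  by (rule blinfun_eqI)
     (simp add: bidual_lift_apply assms LinfB_add LinfB_blinfun_apply lift_fun_add blinfun.add_left
        blinfun.add_right)

lemma bidual_lift_scaleR:
  assumes "v \<in> LinfB M"
  shows "bidual_lift (\<lambda>y. c *\<^sub>R v y) x = c *\<^sub>R bidual_lift v x"
  by (rule blinfun_eqI)
     (simp add: bidual_lift_apply assms LinfB_scaleR LinfB_blinfun_apply lift_fun_scaleR[simplified]
        blinfun.scaleR_left blinfun.scaleR_right)

lemma bidual_lift_diff:
  assumes "v \<in> LinfB M" "w \<in> LinfB M"
  shows "bidual_lift (\<lambda>y. v y - w y) x = bidual_lift v x - bidual_lift w x"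
  by (rule blinfun_eqI)
     (simp add: bidual_lift_apply assms LinfB_diff LinfB_blinfun_apply lift_fun_diff blinfun.diff_left
        blinfun.diff_right)

lemma Linf_scaleR_LinfB:
  assumes "f \<in> Linf M" "v \<in> LinfB M"
  shows "(\<lambda>y. f y *\<^sub>R v y) \<in> LinfB M"
proof -
  obtain C where "\<And>x. \<bar>f x\<bar> \<le> C" using Linf_bounded[OF assms(1)] by blast
  then show ?thesis by (rule LinfB_fun_scaleR[OF Linf_measurable[OF assms(1)] _ assms(2)])
qed

text \<open>The source of (c): after applying a functional, the limit of a product of scalar
  functions is the product of the limits.\<close>

lemma bidual_lift_fun_scaleR:
  assumes f: "f \<in> Linf M" and v: "v \<in> LinfB M" and x: "x \<in> space M"
  shows "bidual_lift (\<lambda>y. f y *\<^sub>R v y) x = lift_fun f x *\<^sub>R bidual_lift v x"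
proof (rule blinfun_eqI)
  fix \<phi>
  have "lift_fun (\<lambda>y. f y * blinfun_apply \<phi> (v y)) x = lift_fun f x * lift_fun (\<lambda>y. blinfun_apply \<phi> (v y)) x"
    by (intro lift_fun_eqI x tendsto_mult tendsto_lift_fun f LinfB_blinfun_apply v)
  then show "blinfun_apply (bidual_lift (\<lambda>y. f y *\<^sub>R v y) x) \<phi> =
      blinfun_apply (lift_fun f x *\<^sub>R bidual_lift v x) \<phi>"
    by (simp add: bidual_lift_apply[OF v] bidual_lift_apply[OF Linf_scaleR_LinfB[OF f v]]
        blinfun.scaleR_left blinfun.scaleR_right)
qed

text \<open>Where \<open>v\<close> converges in norm, its compositions with all functionals converge
  simultaneously, so the null set does not depend on the functional.\<close>

lemma AE_bidual_lift:
  assumes v: "v \<in> LinfB M"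
  shows "AE x in M. bidual_lift v x = canonical_embedding (v x)"
  using AE_tendsto_lifting_filter[OF LinfB_strongly_measurable[OF v]] AE_space
proof eventually_elim
  case (elim x)
  show ?case
  proof (rule blinfun_eqI)
    fix \<phi>
    have "lift_fun (\<lambda>y. blinfun_apply \<phi> (v y)) x = blinfun_apply \<phi> (v x)"
      using elim by (intro lift_fun_eqI blinfun.tendsto tendsto_const)
    then show "blinfun_apply (bidual_lift v x) \<phi> = blinfun_apply (canonical_embedding (v x)) \<phi>"
      by (simp add: bidual_lift_apply[OF v] canonical_embedding_apply)
  qed
qed

lemma bidual_lift_LinfB:
  assumes v: "v \<in> LinfB M"
  shows "bidual_lift v \<in> LinfB M"
proof -
  interpret J: bounded_linear "canonical_embedding :: 'b \<Rightarrow> _"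
    by (rule bounded_linear_canonical_embedding)
  obtain C where C: "\<And>x. norm (v x) \<le> C" using LinfB_bounded[OF v] by blast
  have "strongly_measurable M (\<lambda>x. canonical_embedding (v x))"
    \<comment> \<open>A unary composition, obtained from the binary rule by ignoring the second
      argument.\<close>
    using strongly_measurable_compose2[of v v "\<lambda>a b. canonical_embedding a"]
      LinfB_strongly_measurable[OF v] J.zero
    by (simp add: J.continuous_on continuous_intros)
  then have "strongly_measurable M (bidual_lift v)"
    using AE_bidual_lift[OF v] by (rule strongly_measurable_AE_cong)
  then show ?thesis
  proof (rule LinfBI)
    fix x assume "x \<in> space M"
    then have "lift_fun (\<lambda>y. norm (v y)) x \<le> C"
      using abs_lift_fun_le[OF LinfB_norm[OF v], of x C] C by simp
    with norm_bidual_lift_le[OF v] show "norm (bidual_lift v x) \<le> C" by (rule order_trans)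
  next
    fix x assume "x \<notin> space M"
    then show "bidual_lift v x = 0"
      by (intro blinfun_eqI) (simp add: bidual_lift_apply[OF v] lift_fun_def)
  qed
qed

subsection \<open>The precise representative\<close>

text \<open>Resolves the definite description in \<open>class_integral\<close>: boundedness on a set
  of finite measure gives existence, and a.e. equality of representatives gives uniqueness.\<close>

lemma has_bochner_int_class_integral:
  fixes v :: "'a \<Rightarrow> 'b::banach"
  assumes v: "v \<in> LinfB M" and A: "A \<in> sets M" "emeasure M A \<noteq> \<infinity>"
  shows "has_bochner_int M (\<lambda>x. indicat_real A x *\<^sub>R v x) (class_integral M A (ae_class M (LinfB M) v))"
proof -
  obtain C where C: "\<And>x. norm (v x) \<le> C" using LinfB_bounded[OF v] by blast
  obtain z where z: "has_bochner_int M (\<lambda>x. indicat_real A x *\<^sub>R v x) z"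
    using has_bochner_int_exists[OF LinfB_strongly_measurable[OF v] A C] by blast
  have "class_integral M A (ae_class M (LinfB M) v) = z"
    unfolding class_integral_def
  proof (rule the_equality)
    show "\<exists>w\<in>ae_class M (LinfB M) v. has_bochner_int M (\<lambda>x. indicat_real A x *\<^sub>R w x) z"
      using z ae_class_self[OF v] by blast
    fix y assume "\<exists>w\<in>ae_class M (LinfB M) v. has_bochner_int M (\<lambda>x. indicat_real A x *\<^sub>R w x) y"
    then obtain w where w: "AE x in M. w x = v x" "has_bochner_int M (\<lambda>x. indicat_real A x *\<^sub>R w x) y"
      by (auto simp: ae_class_def)
    have "AE x in M. indicat_real A x *\<^sub>R w x = indicat_real A x *\<^sub>R v x"
      using w(1) by eventually_elim simp
    then show "y = z" by (rule has_bochner_int_unique_AE[OF w(2) z])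
  qed
  with z show ?thesis by simp
qed

text \<open>Compares the integral of \<open>v\<close> over \<open>A\<close> with that of the
  constant \<open>b\<close>, then divides by the measure of \<open>A\<close>.\<close>

lemma average_near:
  fixes v :: "'a \<Rightarrow> 'b::banach"
  assumes v: "v \<in> LinfB M" and A: "A \<in> sets M" "0 < emeasure M A" "emeasure M A \<noteq> \<infinity>"
    and near: "AE x in M. x \<in> A \<longrightarrow> norm (v x - b) \<le> e" and "0 \<le> e"
  shows "norm ((1 / measure M A) *\<^sub>R class_integral M A (ae_class M (LinfB M) v) - b) \<le> e"
proof -
  let ?z = "class_integral M A (ae_class M (LinfB M) v)"
  have pos: "0 < measure M A"
    using A by (simp add: measure_def enn2real_positive_iff less_top)
  have "ennreal (norm (?z - measure M A *\<^sub>R b)) \<le> (\<integral>\<^sup>+x. ennreal e * indicator A x \<partial>M)"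
  proof (rule has_bochner_int_norm_diff_le[OF has_bochner_int_class_integral has_bochner_int_indicator])
    show "AE x in M. ennreal (norm (indicat_real A x *\<^sub>R v x - indicat_real A x *\<^sub>R b)) \<le> ennreal e * indicator A x"
      using near by eventually_elim (auto simp: indicator_def intro: ennreal_leI)
  qed (use v A in auto)
  also have "\<dots> = ennreal (e * measure M A)"
    using A \<open>0 \<le> e\<close> by (simp add: nn_integral_cmult_indicator emeasure_eq_ennreal_measure ennreal_mult)
  finally have "norm (?z - measure M A *\<^sub>R b) \<le> e * measure M A"
    using \<open>0 \<le> e\<close> by (simp add: ennreal_le_iff)
  moreover have "(1 / measure M A) *\<^sub>R ?z - b = (1 / measure M A) *\<^sub>R (?z - measure M A *\<^sub>R b)"
    using pos by (simp add: scaleR_diff_right)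
  ultimately show ?thesis
    using pos by (simp add: divide_le_eq)
qed

lemma lifted_sets_atE:
  assumes "I \<in> lifted_sets_at M l x"
  obtains E where "E \<in> sets M" "0 < emeasure M E" "emeasure M E < \<infinity>" "I = l E" "x \<in> l E"
  using assms by (auto simp: lifted_sets_at_def lifted_sets_def)

lemma lifted_sets_atI:
  assumes "E \<in> sets M" "emeasure M E < \<infinity>" "x \<in> l E"
  shows "l E \<in> lifted_sets_at M l x"
  using assms emeasure_pos_if_lift[OF assms(1,3)]
  unfolding lifted_sets_at_def lifted_sets_def mem_Collect_eq by (intro conjI exI[of _ E] refl)

lemma lifting_limitD:
  assumes "lifting_limit M l x \<Phi> z" "open U" "z \<in> U"
  shows "\<exists>I\<in>lifted_sets_at M l x. \<forall>J\<in>lifted_sets_at M l x. J \<subseteq> I \<longrightarrow> \<Phi> J \<in> U"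
  using assms by (simp add: lifting_limit_def)

text \<open>The lifted sets at \<open>x\<close> are directed downwards:
  \<open>l (E \<inter> F)\<close> is again one of them, with positive measure because it contains
  \<open>x\<close>. A set below both witnesses contradicts the separation.\<close>

lemma lifting_limit_unique:
  fixes y z :: "'c::t2_space"
  assumes y: "lifting_limit M l x \<Phi> y" and z: "lifting_limit M l x \<Phi> z"
  shows "y = z"
proof (rule ccontr)
  assume "y \<noteq> z"
  then obtain U W where UW: "open U" "open W" "y \<in> U" "z \<in> W" "U \<inter> W = {}"
    by (rule hausdorff[THEN exE]) blast
  obtain I where I: "I \<in> lifted_sets_at M l x" "\<forall>J\<in>lifted_sets_at M l x. J \<subseteq> I \<longrightarrow> \<Phi> J \<in> U"
    using lifting_limitD[OF y UW(1,3)] by (rule bexE)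
  obtain I' where I': "I' \<in> lifted_sets_at M l x" "\<forall>J\<in>lifted_sets_at M l x. J \<subseteq> I' \<longrightarrow> \<Phi> J \<in> W"
    using lifting_limitD[OF z UW(2,4)] by (rule bexE)
  obtain E where E: "E \<in> sets M" "0 < emeasure M E" "emeasure M E < \<infinity>" "I = l E" "x \<in> l E"
    using I(1) by (rule lifted_sets_atE)
  obtain F where F: "F \<in> sets M" "0 < emeasure M F" "emeasure M F < \<infinity>" "I' = l F" "x \<in> l F"
    using I'(1) by (rule lifted_sets_atE)
  have "emeasure M (E \<inter> F) \<le> emeasure M E" using E F by (intro emeasure_mono) auto
  then have "emeasure M (E \<inter> F) < \<infinity>" using E(3) by (rule le_less_trans)
  then have J: "l (E \<inter> F) \<in> lifted_sets_at M l x"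
    using E F by (intro lifted_sets_atI) (auto simp: lift_Int)
  have "l (E \<inter> F) \<subseteq> I" "l (E \<inter> F) \<subseteq> I'" using E F by (auto simp: lift_Int)
  then have "\<Phi> (l (E \<inter> F)) \<in> U \<inter> W" using J I(2) I'(2) by simp
  with UW(5) show False by simp
qed

text \<open>A set \<open>E\<close> of the filter on which \<open>v\<close> is close to
  \<open>v x\<close> may have infinite measure; intersecting it with \<open>B\<close> makes its
  lifting admissible.\<close>

lemma lifting_limit_average:
  fixes v :: "'a \<Rightarrow> 'b::banach"
  assumes v: "v \<in> LinfB M" and lim: "(v \<longlongrightarrow> v x) (lifting_filter x)"
    and B: "B \<in> sets M" "emeasure M B \<noteq> \<infinity>" "x \<in> l B"
  shows "lifting_limit M l x
    (\<lambda>I. (1 / measure M I) *\<^sub>R class_integral M I (ae_class M (LinfB M) v)) (v x)"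
proof -
  have x: "x \<in> space M" using B sets.sets_into_space[OF lift_sets] by blast
  have mem: "l E \<in> lifted_sets_at M l x" if "E \<in> sets M" "x \<in> l E" "E \<subseteq> B" for E
  proof -
    have "emeasure M E \<le> emeasure M B" using that B by (intro emeasure_mono)
    then have "emeasure M E < \<infinity>" using B(2) by (simp add: less_top le_less_trans)
    with that show ?thesis by (intro lifted_sets_atI)
  qed
  show ?thesis
    unfolding lifting_limit_def
  proof (intro conjI allI impI)
    show "lifted_sets_at M l x \<noteq> {}" using mem[OF B(1,3) subset_refl] by auto
  next
    fix U assume U: "open U \<and> v x \<in> U"
    then obtain e where e: "e > 0" "\<And>y. dist y (v x) < e \<Longrightarrow> y \<in> U"
      unfolding open_dist by blast
    \<comment> \<open>Half of \<open>e\<close>, because averaging preserves only the weak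
      inequality.\<close>
    have "eventually (\<lambda>y. dist (v y) (v x) < e / 2) (lifting_filter x)"
      using e(1) by (intro tendstoD[OF lim]) simp
    then obtain E where E: "E \<in> sets M" "x \<in> l E" "\<And>y. y \<in> E \<Longrightarrow> dist (v y) (v x) < e / 2"
      unfolding eventually_lifting_filter[OF x] by blast
    have BE: "B \<inter> E \<in> sets M" "x \<in> l (B \<inter> E)" using B E by (auto simp: lift_Int)
    show "\<exists>I\<in>lifted_sets_at M l x. \<forall>J\<in>lifted_sets_at M l x. J \<subseteq> I \<longrightarrow>
        (1 / measure M J) *\<^sub>R class_integral M J (ae_class M (LinfB M) v) \<in> U"
    proof (intro bexI ballI impI)
      show "l (B \<inter> E) \<in> lifted_sets_at M l x" by (rule mem[OF BE]) simp
      fix J assume J: "J \<in> lifted_sets_at M l x" and sub: "J \<subseteq> l (B \<inter> E)"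
      obtain F where F: "F \<in> sets M" "0 < emeasure M F" "emeasure M F < \<infinity>" "J = l F" "x \<in> l F"
        using J by (rule lifted_sets_atE)
      have "norm ((1 / measure M J) *\<^sub>R class_integral M J (ae_class M (LinfB M) v) - v x) \<le> e / 2"
      proof (rule average_near[OF v])
        show "J \<in> sets M" "0 < emeasure M J" "emeasure M J \<noteq> \<infinity>"
          using F(1-3) unfolding F(4) by (simp_all add: lift_sets emeasure_lift)
        \<comment> \<open>\<open>J\<close> lies in the lifting of \<open>B \<inter> E\<close>, while
          closeness is known on \<open>E\<close> itself; the two sets agree a.e.\<close>
        show "AE y in M. y \<in> J \<longrightarrow> norm (v y - v x) \<le> e / 2"
          using AE_lift_iff[OF BE(1)]
        proof eventually_elim
          case (elim y)
          show ?case
          proof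
            assume "y \<in> J"
            then have "y \<in> E" using sub elim by blast
            from E(3)[OF this] show "norm (v y - v x) \<le> e / 2" by (simp add: dist_norm)
          qed
        qed
      qed (use e in simp)
      then show "(1 / measure M J) *\<^sub>R class_integral M J (ae_class M (LinfB M) v) \<in> U"
        using e(1) by (intro e(2)) (simp add: dist_norm)
    qed
  qed
qed

text \<open>An exhaustion by sets of finite measure that agree a.e. with their liftings supplies the
  set \<open>B\<close> of \<open>lifting_limit_average\<close> at almost every point. There the
  limit is \<open>v x\<close>, which lies in the fibre, so the default value 0 is not taken.\<close>

lemma AE_precise_rep:
  fixes v :: "'a \<Rightarrow> 'b::banach"
  assumes v: "v \<in> LinfB M" and E: "\<And>x. x \<in> space M \<Longrightarrow> v x \<in> E x"
  shows "AE x in M. precise_rep M l E (ae_class M (LinfB M) v) x = v x"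
proof -
  obtain A :: "nat \<Rightarrow> 'a set" where A: "range A \<subseteq> sets M" "(\<Union>i. A i) = space M"
      "\<And>i. emeasure M (A i) \<noteq> \<infinity>"
    by (rule sigma_finite) blast
  have "AE x in M. \<forall>i. x \<in> A i \<longleftrightarrow> x \<in> l (A i)"
    using A(1) by (auto simp: AE_all_countable intro!: AE_lift_iff)
  with AE_tendsto_lifting_filter[OF LinfB_strongly_measurable[OF v]] AE_space
  show ?thesis
  proof eventually_elim
    case (elim x)
    obtain i where "x \<in> A i" using elim(2) A(2) by blast
    with elim have "x \<in> l (A i)" by blast
    then have "lifting_limit M l x
        (\<lambda>I. (1 / measure M I) *\<^sub>R class_integral M I (ae_class M (LinfB M) v)) (v x)"
      using A by (intro lifting_limit_average[OF v elim(1), of "A i"]) auto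
    moreover note E[OF elim(2)]
    ultimately show ?case
      unfolding precise_rep_def Let_def
      by (auto intro!: the_equality elim: lifting_limit_unique)
  qed
qed

section \<open>The lifting on classes of sections\<close>

definition class_lift ::
  "('a \<Rightarrow> 'b::real_normed_vector) set \<Rightarrow> 'a \<Rightarrow> (('b \<Rightarrow>\<^sub>L real) \<Rightarrow>\<^sub>L real)" where
  "class_lift V = bidual_lift (SOME v. v \<in> V)"

lemma class_lift_ae_class:
  assumes "v \<in> LinfB M"
  shows "class_lift (ae_class M (LinfB M) v) = bidual_lift v"
proof -
  have "(SOME w. w \<in> ae_class M (LinfB M) v) \<in> ae_class M (LinfB M) v"
    using ae_class_self[OF assms] by (rule someI[of "\<lambda>w. w \<in> ae_class M (LinfB M) v"])
  then show ?thesis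
    unfolding class_lift_def by (intro bidual_lift_cong) (auto simp: ae_class_def)
qed

text \<open>The lifting does not increase norms, so \<open>d = e\<close> works: the lifted norm of
  the difference is also the lifting of a representative \<open>h\<close> with supremum norm below
  \<open>e\<close>.\<close>

lemma continuous_class_lift:
  assumes D: "D \<subseteq> ae_class M (LinfB M) ` LinfB M"
  shows "continuous_on_classes M (LinfB M) D (quot_LinfB_norm M) class_lift"
  unfolding continuous_on_classes_def
proof (intro ballI allI impI)
  fix V and e :: real assume "V \<in> D" "e > 0"
  then obtain v where v: "v \<in> LinfB M" "V = ae_class M (LinfB M) v" using D by blast
  have "sup_norm M (\<lambda>x. class_lift W x - class_lift V x) < e"
    if W: "W \<in> D" and small: "quot_LinfB_norm M (lift2 M (LinfB M) (-) W V) < e" for W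
  proof -
    obtain w where w: "w \<in> LinfB M" "W = ae_class M (LinfB M) w" using W D by blast
    have wv: "(\<lambda>x. w x - v x) \<in> LinfB M" by (intro LinfB_diff v w)
    obtain h where h: "h \<in> Linf M" "AE x in M. h x = norm (w x - v x)" "sup_norm M h < e"
      using small unfolding quot_LinfB_norm_def v(2) w(2) lift2_ae_class[OF w(1) v(1)] lift1_ae_class[OF wv]
      by (rule quot_Linf_norm_less[OF LinfB_norm[OF wv]])
    have "sup_norm M (\<lambda>x. class_lift W x - class_lift V x) \<le> sup_norm M h"
    proof (intro sup_norm_le space_nonempty)
      fix x assume "x \<in> space M"
      have "norm (class_lift W x - class_lift V x) \<le> lift_fun h x"
        using norm_bidual_lift_le[OF wv, of x]
        by (simp add: v w class_lift_ae_class bidual_lift_diff lift_fun_cong[OF h(1,2)])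
      also have "\<dots> \<le> sup_norm M h"
        using abs_lift_fun_le_sup_norm[OF h(1) \<open>x \<in> space M\<close>] by linarith
      finally show "norm (class_lift W x - class_lift V x) \<le> sup_norm M h" .
    qed
    with h(3) show ?thesis by linarith
  qed
  with \<open>e > 0\<close> show "\<exists>d>0. \<forall>W\<in>D. quot_LinfB_norm M (lift2 M (LinfB M) (-) W V) < d \<longrightarrow>
      sup_norm M (\<lambda>x. class_lift W x - class_lift V x) < e"
    by blast
qed

text \<open>The source of (e): composed with a functional, the constant section is constant on the
  space, hence so is the limit along every filter.\<close>

lemma class_lift_const:
  assumes "x \<in> space M"
  shows "class_lift (lift1 M (LinfB M) (\<lambda>r. r *\<^sub>R b) (ae_class M (Linf M) (indicat_real (space M)))) x =
    canonical_embedding b"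
proof -
  let ?v = "\<lambda>y. indicat_real (space M) y *\<^sub>R b"
  have v: "?v \<in> LinfB M"
  proof (rule LinfBI)
    show "strongly_measurable M ?v"
      by (intro strongly_measurable_scaleR strongly_measurable_const) (unfold_locales, simp)
    show "norm (?v x) \<le> norm b" for x by (simp add: indicator_def)
  qed simp
  have "blinfun_apply (bidual_lift ?v x) \<phi> = blinfun_apply (canonical_embedding b) \<phi>" for \<phi>
  proof -
    have "eventually (\<lambda>y. blinfun_apply \<phi> b = blinfun_apply \<phi> (?v y)) (lifting_filter x)"
      using eventually_lifting_filter_space[OF assms] by eventually_elim simp
    from lift_fun_eqI[OF assms Lim_transform_eventually[OF tendsto_const this]] show ?thesis
      by (simp add: bidual_lift_apply[OF v] canonical_embedding_apply)
  qed
  then have "bidual_lift ?v x = canonical_embedding b" by (rule blinfun_eqI)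
  then show ?thesis
    by (simp add: lift1_ae_class Linf_indicator class_lift_ae_class[OF v])
qed

end

theorem theorem4p4:
  fixes M :: "'x measure"
    and l :: "'x set \<Rightarrow> 'x set"
    and E :: "'x \<Rightarrow> 'b::banach set"
  assumes "complete_measure M"
    and "sigma_finite_measure M"
    and "von_neumann_lifting M l"
    and "banach_bundle M E"
  shows "\<exists>L :: ('x \<Rightarrow> 'b) set \<Rightarrow> 'x \<Rightarrow> (('b \<Rightarrow>\<^sub>L real) \<Rightarrow>\<^sub>L real).
     L \<in> Gamma_inf M E \<rightarrow> LinfB M \<and>
     (\<forall>V\<in>Gamma_inf M E.
        AE x in M. L V x = canonical_embedding (precise_rep M l E V x)) \<and>
     (\<forall>V\<in>Gamma_inf M E. \<forall>W\<in>Gamma_inf M E. \<forall>x\<in>space M.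
        L (lift2 M (LinfB M) (+) V W) x = L V x + L W x) \<and>
     (\<forall>V\<in>Gamma_inf M E. \<forall>F\<in>quot_Linf M. \<forall>x\<in>space M.
        L (lift2 M (LinfB M) (*\<^sub>R) F V) x = fun_lifting M l F x *\<^sub>R L V x) \<and>
     (\<forall>V\<in>Gamma_inf M E. \<forall>x\<in>space M.
        norm (L V x) \<le> fun_lifting M l (lift1 M (Linf M) norm V) x) \<and>
     linear_on_classes M (LinfB M) (Gamma_inf M E) L \<and>
     continuous_on_classes M (LinfB M) (Gamma_inf M E) (quot_LinfB_norm M) L \<and>
     ((\<forall>x\<in>space M. E x = UNIV) \<longrightarrow>
        (\<forall>b. \<forall>x\<in>space M.
           L (lift1 M (LinfB M) (\<lambda>r. r *\<^sub>R b) (ae_class M (Linf M) (indicat_real (space M)))) x =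
             canonical_embedding b))"
proof -
  interpret complete_measure M by fact
  interpret sigma_finite_measure M by fact
  interpret measure_lifting M l by unfold_locales fact
  \<comment> \<open>The representative takes values in the fibres everywhere, as
    \<open>precise_rep\<close> tests its limit for membership in \<open>E x\<close>.\<close>
  have rep: "\<exists>v\<in>LinfB M. V = ae_class M (LinfB M) v \<and> (\<forall>x\<in>space M. v x \<in> E x)"
    if "V \<in> Gamma_inf M E" for V
    using that by (auto simp: Gamma_inf_def Gamma_bar_def)
  have "class_lift \<in> Gamma_inf M E \<rightarrow> LinfB M"
  proof
    fix V assume "V \<in> Gamma_inf M E"
    from rep[OF this] show "class_lift V \<in> LinfB M"
      by (auto simp: class_lift_ae_class bidual_lift_LinfB)
  qed
  moreover have "AE x in M. class_lift V x = canonical_embedding (precise_rep M l E V x)"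
    if V: "V \<in> Gamma_inf M E" for V
  proof -
    obtain v where v: "v \<in> LinfB M" "V = ae_class M (LinfB M) v" "\<And>x. x \<in> space M \<Longrightarrow> v x \<in> E x"
      using rep[OF V] by blast
    have "AE x in M. precise_rep M l E V x = v x"
      unfolding v(2) using v(1,3) by (rule AE_precise_rep)
    with AE_bidual_lift[OF v(1)] show ?thesis
      unfolding v(2) class_lift_ae_class[OF v(1)] by eventually_elim simp
  qed
  moreover have add: "class_lift (lift2 M (LinfB M) (+) V W) x = class_lift V x + class_lift W x"
    if "V \<in> Gamma_inf M E" "W \<in> Gamma_inf M E" for V W x
    using rep[OF that(1)] rep[OF that(2)]
    by (auto simp: lift2_ae_class class_lift_ae_class LinfB_add bidual_lift_add)
  moreover have "class_lift (lift2 M (LinfB M) (*\<^sub>R) F V) x = fun_lifting M l F x *\<^sub>R class_lift V x"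
    if "V \<in> Gamma_inf M E" "F \<in> quot_Linf M" "x \<in> space M" for V F x
    using rep[OF that(1)] that(2,3)
    by (auto simp: quot_Linf_def lift2_ae_class class_lift_ae_class Linf_scaleR_LinfB
        fun_lifting_ae_class bidual_lift_fun_scaleR)
  moreover have "norm (class_lift V x) \<le> fun_lifting M l (lift1 M (Linf M) norm V) x"
    if "V \<in> Gamma_inf M E" for V x
    using rep[OF that]
    by (auto simp: lift1_ae_class class_lift_ae_class fun_lifting_ae_class LinfB_norm norm_bidual_lift_le)
  moreover have "class_lift (lift1 M (LinfB M) ((*\<^sub>R) c) V) x = c *\<^sub>R class_lift V x"
    if "V \<in> Gamma_inf M E" for V c x
    using rep[OF that]
    by (auto simp: lift1_ae_class class_lift_ae_class LinfB_scaleR bidual_lift_scaleR)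
  moreover have "continuous_on_classes M (LinfB M) (Gamma_inf M E) (quot_LinfB_norm M) class_lift"
    using rep by (intro continuous_class_lift) blast
  ultimately show ?thesis
    unfolding linear_on_classes_def by (intro exI[of _ class_lift]) (simp add: class_lift_const)
qed

end
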